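(* Let $\mathbb{F}_1,\mathbb{F}_2,\mathbb{F}_3$ be graded Fréchet spaces with sequences of associated local Banach spaces $(\mathbb{F}_a^n)_{n\in\mathbb{N}}$ and bonding maps ${}_a\delta_i^j:\mathbb{F}_a^j\to\mathbb{F}_a^i$ ($j\ge i$), $a=1,2,3$, and let $(r,s)\in\mathbb{N}\times\mathbb{N}$. Let $(\varphi_n)_{n\ge s}$ be a projective sequence of local shift morphisms of type $(r,s)$ above open sets $U_n\subset\mathbb{F}_1^n$, that is: (i) for each $n\ge s$, $U_n$ is an open subset of $\mathbb{F}_1^n$ and $\varphi_n:U_n\to\mathcal{L}(\mathbb{F}_2^{n+r},\mathbb{F}_3^{n-s})$ is a smooth map; (ii) ${}_1\delta_n^{n+1}(U_{n+1})\subset U_n$ for all $n\ge s$, and $U=\{q=(q_n)_{n\in\mathbb{N}}\in\mathbb{F}_1: q_n\in U_n\text{ for all }n\ge s\}$ is a non-empty open subset of $\mathbb{F}_1$; (iii) for every $q=(q_n)_{n\in\mathbb{N}}\in U$ and every $n\ge s$, $${}_3\delta_{n-s}^{n-s+1}\circ\varphi_{n+1}(q_{n+1})=\varphi_n(q_n)\circ{}_2\delta_{n+r}^{n+r+1}.$$ Then the projective limit $\varphi=\varprojlim\varphi_n$, $\varphi(q)=(\varphi_n(q_n))_{n\ge s}$ for $q=(q_n)_{n\in\mathbb{N}}\in U$, is a smooth map from the open set $U$ of the Fréchet space $\mathbb{F}_1$ to the Fréchet space $\mathcal{L}^{r,s}(\mathbb{F}_2,\mathbb{F}_3)$.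
   Context: Graded Fréchet spaces and local Banach spaces. A graded Fréchet space is a Fréchet space $\mathbb{F}$ with a fixed increasing sequence of semi-norms $\nu_0\le\nu_1\le\cdots$ defining its topology. The local Banach space $\mathbb{F}^n$ is the completion of the normed space $\mathbb{F}/\ker\nu_n$ (norm induced by $\nu_n$). The bonding maps $\delta_i^j:\mathbb{F}^j\to\mathbb{F}^i$, $j\ge i$, are the continuous linear maps induced by $x+\ker\nu_j\mapsto x+\ker\nu_i$. The space $\mathbb{F}$ is identified with the projective limit $\varprojlim\mathbb{F}^n$, i.e. the space of threads $(x_n)_n\in\prod_n\mathbb{F}^n$ with $\delta_i^j(x_j)=x_i$ for $j\ge i$, with the coarsest topology making all projections to $\mathbb{F}^n$ continuous. The space $\mathcal{L}^{r,s}(\mathbb{F}_2,\mathbb{F}_3)$. For Banach spaces, $\mathcal{L}(E,F)$ is the Banach space of continuous linear maps with the operator norm. For $n\ge s$ let $\mathcal{L}_{s,n}^{r,s}(\mathbb{F}_2,\mathbb{F}_3)$ be the Banach space of tuples $(L_s,\dots,L_n)\in\prod_{i=s}^n\mathcal{L}(\mathbb{F}_2^{i+r},\mathbb{F}_3^{i-s})$ such that ${}_3\delta_{i-s}^{j-s}\circ L_j=L_i\circ{}_2\delta_{i+r}^{j+r}$ for all $n\ge j\ge i\ge s$, with norm the sum of the operator norms of the $L_i$. Then $\mathcal{L}^{r,s}(\mathbb{F}_2,\mathbb{F}_3)$ is the projective limit of these Banach spaces under the truncation maps $(L_s,\dots,L_j)\mapsto(L_s,\dots,L_i)$; its elements are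 identified with sequences $(L_n)_{n\ge s}$, $L_n\in\mathcal{L}(\mathbb{F}_2^{n+r},\mathbb{F}_3^{n-s})$, satisfying ${}_3\delta_{i-s}^{j-s}\circ L_j=L_i\circ{}_2\delta_{i+r}^{j+r}$ for all $j\ge i\ge s$. With the projective limit topology it is a Fréchet space. Smoothness (in the sense of Leslie). Let $E,F$ be Hausdorff locally convex spaces and $U\subset E$ open. A continuous map $f:U\to F$ is differentiable at $x\in U$ if there is a continuous linear map $Df_x:E\to F$ such that the map $R(t,v)=\frac{f(x+tv)-f(x)-Df_x(tv)}{t}$ for $t\ne0$, $R(0,v)=0$, is continuous at every $(0,v)\in\mathbb{R}\times E$. It is $C^1$ if it is differentiable at every $x\in U$ and $Df:U\times E\to F$, $(x,v)\mapsto Df_x(v)$, is continuous; it is $C^n$ ($n\ge2$) if it is $C^1$ and $Df:U\times E\to F$ is $C^{n-1}$; it is smooth if it is $C^n$ for all $n$. Between Banach spaces, smooth is equivalent to smooth in the usual Fréchet-derivative sense. *)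

theory Defs
  imports "HOL-Analysis.Analysis"
begin

section \<open>Real vector spaces with explicit carrier\<close>

text \<open>The local Banach spaces depend on an index, and the operator spaces depend on
  \<open>r\<close>, \<open>s\<close> and on the gradings, so none of them can be a type. They are records with an
  explicit carrier; what the operations do outside the carrier is irrelevant.\<close>

record 'a vspace =
  vcarrier :: "'a set"
  vzero :: 'a
  vadd :: "'a \<Rightarrow> 'a \<Rightarrow> 'a"
  vscale :: "real \<Rightarrow> 'a \<Rightarrow> 'a"

record 'a nspace = "'a vspace" +
  vnorm :: "'a \<Rightarrow> real"

record 'a tspace = "'a vspace" +
  vtopo :: "'a topology"

definition vminus :: "('a, 'm) vspace_scheme \<Rightarrow> 'a \<Rightarrow> 'a \<Rightarrow> 'a" where
  "vminus E x y = vadd E x (vscale E (-1) y)"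

text \<open>The guard is needed because \<open>Metric_space\<close> demands nonnegativity and symmetry
  also outside the carrier.\<close>

definition ndist :: "'a nspace \<Rightarrow> 'a \<Rightarrow> 'a \<Rightarrow> real" where
  "ndist E x y =
     (if x \<in> vcarrier E \<and> y \<in> vcarrier E then vnorm E (vminus E x y) else 0)"

definition ntopo :: "'a nspace \<Rightarrow> 'a topology" where
  "ntopo E = Metric_space.mtopology (vcarrier E) (ndist E)"

definition tspace_of :: "'a nspace \<Rightarrow> 'a tspace" where
  "tspace_of E = \<lparr>vcarrier = vcarrier E, vzero = vzero E, vadd = vadd E,
     vscale = vscale E, vtopo = ntopo E\<rparr>"

definition linear_between ::
    "('a, 'm) vspace_scheme \<Rightarrow> ('b, 'n) vspace_scheme \<Rightarrow> ('a \<Rightarrow> 'b) \<Rightarrow> bool" where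
  "linear_between E F T \<longleftrightarrow>
     T \<in> vcarrier E \<rightarrow> vcarrier F \<and>
     (\<forall>x\<in>vcarrier E. \<forall>y\<in>vcarrier E. T (vadd E x y) = vadd F (T x) (T y)) \<and>
     (\<forall>c. \<forall>x\<in>vcarrier E. T (vscale E c x) = vscale F c (T x))"

text \<open>The coarsest topology on \<open>S\<close> making all maps \<open>p i\<close>, \<open>i \<in> I\<close>, continuous
  (for \<open>I\<close> nonempty and \<open>p i\<close> mapping \<open>S\<close> into the space of \<open>T i\<close>).\<close>

definition initial_topology ::
    "'a set \<Rightarrow> 'i set \<Rightarrow> ('i \<Rightarrow> 'a \<Rightarrow> 'b) \<Rightarrow> ('i \<Rightarrow> 'b topology) \<Rightarrow> 'a topology" where
  "initial_topology S I p T =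
     topology_generated_by {{x \<in> S. p i x \<in> V} | i V. i \<in> I \<and> openin (T i) V}"


section \<open>Graded Frechet spaces, local Banach spaces, bonding maps\<close>

definition seminorm :: "('a::real_vector \<Rightarrow> real) \<Rightarrow> bool" where
  "seminorm p \<longleftrightarrow>
     (\<forall>x y. p (x + y) \<le> p x + p y) \<and> (\<forall>c x. p (c *\<^sub>R x) = \<bar>c\<bar> * p x)"

text \<open>The topology of the space is the one defined by the seminorms; as there are
  countably many of them, completeness is sequential completeness.\<close>

definition graded_frechet :: "(nat \<Rightarrow> 'a::real_vector \<Rightarrow> real) \<Rightarrow> bool" where
  "graded_frechet \<nu> \<longleftrightarrow>
     (\<forall>n. seminorm (\<nu> n)) \<and>
     (\<forall>n x. \<nu> n x \<le> \<nu> (Suc n) x) \<and>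
     (\<forall>x. (\<forall>n. \<nu> n x = 0) \<longrightarrow> x = 0) \<and>
     (\<forall>x :: nat \<Rightarrow> 'a.
        (\<forall>n. \<forall>e>0. \<exists>N. \<forall>k\<ge>N. \<forall>l\<ge>N. \<nu> n (x k - x l) < e) \<longrightarrow>
        (\<exists>y. \<forall>n. (\<lambda>k. \<nu> n (x k - y)) \<longlonglongrightarrow> 0))"

definition ker_coset :: "('a::real_vector \<Rightarrow> real) \<Rightarrow> 'a \<Rightarrow> 'a set" where
  "ker_coset p x = (\<lambda>k. x + k) ` {k. p k = 0}"

definition quotient_space :: "('a::real_vector \<Rightarrow> real) \<Rightarrow> 'a set nspace" where
  "quotient_space p =
     \<lparr>vcarrier = range (ker_coset p),
      vzero = ker_coset p 0,
      vadd = (\<lambda>A B. \<Union>a\<in>A. \<Union>b\<in>B. ker_coset p (a + b)),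
      vscale = (\<lambda>c A. \<Union>a\<in>A. ker_coset p (c *\<^sub>R a)),
      vnorm = (\<lambda>A. the_elem (p ` A))\<rparr>"

text \<open>Completion of a normed space: Cauchy sequences modulo null sequences.\<close>

definition ncauchy :: "'a nspace \<Rightarrow> (nat \<Rightarrow> 'a) set" where
  "ncauchy E = {x. Metric_space.MCauchy (vcarrier E) (ndist E) x}"

definition null_rel :: "'a nspace \<Rightarrow> ((nat \<Rightarrow> 'a) \<times> (nat \<Rightarrow> 'a)) set" where
  "null_rel E = {(x, y). x \<in> ncauchy E \<and> y \<in> ncauchy E \<and>
     (\<lambda>k. ndist E (x k) (y k)) \<longlonglongrightarrow> 0}"

definition ncompletion :: "'a nspace \<Rightarrow> (nat \<Rightarrow> 'a) set nspace" where
  "ncompletion E =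
     \<lparr>vcarrier = ncauchy E // null_rel E,
      vzero = null_rel E `` {\<lambda>k. vzero E},
      vadd = (\<lambda>X Y. \<Union>x\<in>X. \<Union>y\<in>Y. null_rel E `` {\<lambda>k. vadd E (x k) (y k)}),
      vscale = (\<lambda>c X. \<Union>x\<in>X. null_rel E `` {\<lambda>k. vscale E c (x k)}),
      vnorm = (\<lambda>X. the_elem ((\<lambda>x. lim (\<lambda>k. vnorm E (x k))) ` X))\<rparr>"

text \<open>The extension to the completions of a continuous linear map \<open>f\<close> into \<open>F\<close>.\<close>

definition completion_map ::
    "'b nspace \<Rightarrow> ('a \<Rightarrow> 'b) \<Rightarrow> (nat \<Rightarrow> 'a) set \<Rightarrow> (nat \<Rightarrow> 'b) set" where
  "completion_map F f X = (\<Union>x\<in>X. null_rel F `` {\<lambda>k. f (x k)})"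

definition local_banach ::
    "(nat \<Rightarrow> 'a::real_vector \<Rightarrow> real) \<Rightarrow> nat \<Rightarrow> (nat \<Rightarrow> 'a set) set nspace" where
  "local_banach \<nu> n = ncompletion (quotient_space (\<nu> n))"

text \<open>\<open>bond \<nu> i j\<close>, for \<open>i \<le> j\<close>, goes from the \<open>j\<close>-th to the \<open>i\<close>-th local Banach space.\<close>

definition bond ::
    "(nat \<Rightarrow> 'a::real_vector \<Rightarrow> real) \<Rightarrow> nat \<Rightarrow> nat \<Rightarrow> (nat \<Rightarrow> 'a set) set \<Rightarrow> (nat \<Rightarrow> 'a set) set"
  where
  "bond \<nu> i j =
     completion_map (quotient_space (\<nu> i)) (\<lambda>A. \<Union>a\<in>A. ker_coset (\<nu> i) a)"

definition frechet_threads ::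
    "(nat \<Rightarrow> 'a::real_vector \<Rightarrow> real) \<Rightarrow> (nat \<Rightarrow> (nat \<Rightarrow> 'a set) set) set" where
  "frechet_threads \<nu> =
     {q. (\<forall>n. q n \<in> vcarrier (local_banach \<nu> n)) \<and>
         (\<forall>i j. i \<le> j \<longrightarrow> bond \<nu> i j (q j) = q i)}"

text \<open>The graded Frechet space, identified with the projective limit of its local
  Banach spaces.\<close>

definition frechet_limit ::
    "(nat \<Rightarrow> 'a::real_vector \<Rightarrow> real) \<Rightarrow> (nat \<Rightarrow> (nat \<Rightarrow> 'a set) set) tspace" where
  "frechet_limit \<nu> =
     \<lparr>vcarrier = frechet_threads \<nu>,
      vzero = (\<lambda>n. vzero (local_banach \<nu> n)),
      vadd = (\<lambda>q q' n. vadd (local_banach \<nu> n) (q n) (q' n)),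
      vscale = (\<lambda>c q n. vscale (local_banach \<nu> n) c (q n)),
      vtopo = initial_topology (frechet_threads \<nu>) UNIV (\<lambda>n q. q n)
        (\<lambda>n. ntopo (local_banach \<nu> n))\<rparr>"


section \<open>Spaces of operators\<close>

definition cont_linear_maps :: "'a nspace \<Rightarrow> 'b nspace \<Rightarrow> ('a \<Rightarrow> 'b) set" where
  "cont_linear_maps E F =
     {T \<in> extensional (vcarrier E).
        linear_between E F T \<and> continuous_map (ntopo E) (ntopo F) T}"

definition operator_space :: "'a nspace \<Rightarrow> 'b nspace \<Rightarrow> ('a \<Rightarrow> 'b) nspace" where
  "operator_space E F =
     \<lparr>vcarrier = cont_linear_maps E F,
      vzero = (\<lambda>x\<in>vcarrier E. vzero F),
      vadd = (\<lambda>S T. \<lambda>x\<in>vcarrier E. vadd F (S x) (T x)),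
      vscale = (\<lambda>c T. \<lambda>x\<in>vcarrier E. vscale F c (T x)),
      vnorm = (\<lambda>T. SUP x\<in>{x \<in> vcarrier E. vnorm E x \<le> 1}. vnorm F (T x))\<rparr>"

definition shift_ops ::
    "(nat \<Rightarrow> 'b::real_vector \<Rightarrow> real) \<Rightarrow> (nat \<Rightarrow> 'c::real_vector \<Rightarrow> real) \<Rightarrow> nat \<Rightarrow> nat \<Rightarrow> nat \<Rightarrow>
      ((nat \<Rightarrow> 'b set) set \<Rightarrow> (nat \<Rightarrow> 'c set) set) nspace" where
  "shift_ops \<nu>2 \<nu>3 r s n = operator_space (local_banach \<nu>2 (n + r)) (local_banach \<nu>3 (n - s))"

text \<open>Families of operators indexed by \<open>I\<close> and compatible with the bonding maps:
  \<open>I = {s..n}\<close> gives the tuples \<open>(L\<^sub>s,\<dots>,L\<^sub>n)\<close>, \<open>I = {s..}\<close> the sequences \<open>(L\<^sub>n)\<close>, \<open>n \<ge> s\<close>.\<close>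

definition compatible_ops ::
    "(nat \<Rightarrow> 'b::real_vector \<Rightarrow> real) \<Rightarrow> (nat \<Rightarrow> 'c::real_vector \<Rightarrow> real) \<Rightarrow> nat \<Rightarrow> nat \<Rightarrow> nat set \<Rightarrow>
      (nat \<Rightarrow> (nat \<Rightarrow> 'b set) set \<Rightarrow> (nat \<Rightarrow> 'c set) set) set" where
  "compatible_ops \<nu>2 \<nu>3 r s I =
     {L \<in> (\<Pi>\<^sub>E i\<in>I. vcarrier (shift_ops \<nu>2 \<nu>3 r s i)).
        \<forall>i\<in>I. \<forall>j\<in>I. i \<le> j \<longrightarrow>
          (\<forall>x\<in>vcarrier (local_banach \<nu>2 (j + r)).
             bond \<nu>3 (i - s) (j - s) (L j x) = L i (bond \<nu>2 (i + r) (j + r) x))}"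

definition trunc_shift_space ::
    "(nat \<Rightarrow> 'b::real_vector \<Rightarrow> real) \<Rightarrow> (nat \<Rightarrow> 'c::real_vector \<Rightarrow> real) \<Rightarrow> nat \<Rightarrow> nat \<Rightarrow> nat \<Rightarrow>
      (nat \<Rightarrow> (nat \<Rightarrow> 'b set) set \<Rightarrow> (nat \<Rightarrow> 'c set) set) nspace" where
  "trunc_shift_space \<nu>2 \<nu>3 r s n =
     \<lparr>vcarrier = compatible_ops \<nu>2 \<nu>3 r s {s..n},
      vzero = (\<lambda>i\<in>{s..n}. vzero (shift_ops \<nu>2 \<nu>3 r s i)),
      vadd = (\<lambda>L M. \<lambda>i\<in>{s..n}. vadd (shift_ops \<nu>2 \<nu>3 r s i) (L i) (M i)),
      vscale = (\<lambda>c L. \<lambda>i\<in>{s..n}. vscale (shift_ops \<nu>2 \<nu>3 r s i) c (L i)),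
      vnorm = (\<lambda>L. \<Sum>i = s..n. vnorm (shift_ops \<nu>2 \<nu>3 r s i) (L i))\<rparr>"

text \<open>The projective limit of the truncated spaces, its elements being identified with
  infinite sequences; the projections are the truncations.\<close>

definition shift_space ::
    "(nat \<Rightarrow> 'b::real_vector \<Rightarrow> real) \<Rightarrow> (nat \<Rightarrow> 'c::real_vector \<Rightarrow> real) \<Rightarrow> nat \<Rightarrow> nat \<Rightarrow>
      (nat \<Rightarrow> (nat \<Rightarrow> 'b set) set \<Rightarrow> (nat \<Rightarrow> 'c set) set) tspace" where
  "shift_space \<nu>2 \<nu>3 r s =
     \<lparr>vcarrier = compatible_ops \<nu>2 \<nu>3 r s {s..},
      vzero = (\<lambda>i\<in>{s..}. vzero (shift_ops \<nu>2 \<nu>3 r s i)),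
      vadd = (\<lambda>L M. \<lambda>i\<in>{s..}. vadd (shift_ops \<nu>2 \<nu>3 r s i) (L i) (M i)),
      vscale = (\<lambda>c L. \<lambda>i\<in>{s..}. vscale (shift_ops \<nu>2 \<nu>3 r s i) c (L i)),
      vtopo = initial_topology (compatible_ops \<nu>2 \<nu>3 r s {s..}) {s..}
        (\<lambda>n L. restrict L {s..n}) (\<lambda>n. ntopo (trunc_shift_space \<nu>2 \<nu>3 r s n))\<rparr>"


section \<open>Smoothness in the sense of Leslie\<close>

text \<open>\<open>leslie_deriv E F U f x D\<close>: the continuous linear map \<open>D\<close> is the derivative at \<open>x\<close> of
  \<open>f\<close>, defined on the open set \<open>U\<close> of \<open>E\<close>. The remainder is regarded as a map on the set of
  those \<open>(t, v)\<close> for which \<open>f (x + t v)\<close> makes sense.\<close>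

definition leslie_remainder ::
    "'a tspace \<Rightarrow> 'b tspace \<Rightarrow> ('a \<Rightarrow> 'b) \<Rightarrow> 'a \<Rightarrow> ('a \<Rightarrow> 'b) \<Rightarrow> real \<times> 'a \<Rightarrow> 'b" where
  "leslie_remainder E F f x D = (\<lambda>(t, v).
     if t = 0 then vzero F
     else vscale F (1 / t)
       (vminus F (vminus F (f (vadd E x (vscale E t v))) (f x)) (D (vscale E t v))))"

definition leslie_deriv ::
    "'a tspace \<Rightarrow> 'b tspace \<Rightarrow> 'a set \<Rightarrow> ('a \<Rightarrow> 'b) \<Rightarrow> 'a \<Rightarrow> ('a \<Rightarrow> 'b) \<Rightarrow> bool" where
  "leslie_deriv E F U f x D \<longleftrightarrow>
     linear_between E F D \<and> continuous_map (vtopo E) (vtopo F) D \<and>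
     (\<forall>v\<in>vcarrier E.
        topcontinuous_at
          (subtopology (prod_topology euclideanreal (vtopo E))
             {(t, w). vadd E x (vscale E t w) \<in> U})
          (vtopo F) (leslie_remainder E F f x D) (0, v))"

text \<open>The successive differentials of a map on \<open>E\<close> live on \<open>E \<times> E\<close>, \<open>(E \<times> E) \<times> (E \<times> E)\<close>
  and so on. To define \<open>C\<^sup>n\<close> by recursion on \<open>n\<close>, all these iterated products are placed in
  one type, closed under formation of pairs.\<close>

datatype 'a pairing = Point (the_point: 'a) | Pairing (pfst: "'a pairing") (psnd: "'a pairing")

definition point_space :: "'a tspace \<Rightarrow> 'a pairing tspace" where
  "point_space E =
     \<lparr>vcarrier = Point ` vcarrier E,
      vzero = Point (vzero E),
      vadd = (\<lambda>p q. Point (vadd E (the_point p) (the_point q))),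
      vscale = (\<lambda>c p. Point (vscale E c (the_point p))),
      vtopo = pullback_topology (Point ` vcarrier E) the_point (vtopo E)\<rparr>"

definition pairing_set :: "'a pairing set \<Rightarrow> 'a pairing set \<Rightarrow> 'a pairing set" where
  "pairing_set A B = {Pairing p q | p q. p \<in> A \<and> q \<in> B}"

definition square_space :: "'a pairing tspace \<Rightarrow> 'a pairing tspace" where
  "square_space E =
     \<lparr>vcarrier = pairing_set (vcarrier E) (vcarrier E),
      vzero = Pairing (vzero E) (vzero E),
      vadd = (\<lambda>p q. Pairing (vadd E (pfst p) (pfst q)) (vadd E (psnd p) (psnd q))),
      vscale = (\<lambda>c p. Pairing (vscale E c (pfst p)) (vscale E c (psnd p))),
      vtopo = pullback_topology (pairing_set (vcarrier E) (vcarrier E))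
        (\<lambda>p. (pfst p, psnd p)) (prod_topology (vtopo E) (vtopo E))\<rparr>"

text \<open>\<open>Ck_on 0\<close> is continuity, so that \<open>Ck_on 1\<close> and \<open>Ck_on n\<close>, \<open>n \<ge> 2\<close>, are \<open>C\<^sup>1\<close> and \<open>C\<^sup>n\<close>.
  The differential \<open>Df\<close> is unique on \<open>U \<times> E\<close> because \<open>F\<close> is Hausdorff.\<close>

primrec Ck_on ::
    "nat \<Rightarrow> 'a pairing tspace \<Rightarrow> 'b tspace \<Rightarrow> 'a pairing set \<Rightarrow> ('a pairing \<Rightarrow> 'b) \<Rightarrow> bool" where
  "Ck_on 0 E F U f \<longleftrightarrow> continuous_map (subtopology (vtopo E) U) (vtopo F) f"
| "Ck_on (Suc k) E F U f \<longleftrightarrow>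
     continuous_map (subtopology (vtopo E) U) (vtopo F) f \<and>
     (\<exists>Df. (\<forall>x\<in>U. leslie_deriv E F U f x (Df x)) \<and>
           Ck_on k (square_space E) F (pairing_set U (vcarrier E)) (\<lambda>p. Df (pfst p) (psnd p)))"

definition leslie_smooth ::
    "'a tspace \<Rightarrow> 'b tspace \<Rightarrow> 'a set \<Rightarrow> ('a \<Rightarrow> 'b) \<Rightarrow> bool" where
  "leslie_smooth E F U f \<longleftrightarrow> (\<forall>k. Ck_on k (point_space E) F (Point ` U) (\<lambda>p. f (the_point p)))"

end

theory Submission
  imports Defs
begin

text \<open>A sequence of operators converges in the projective limit iff all its components do, so
  continuity and differentiability of \<open>\<phi>\<close> are checked componentwise; the remainder of \<open>\<phi>\<close> at \<open>q\<close>
  has as its components the remainders of \<open>\<phi>\<^sub>n\<close> at \<open>q\<^sub>n\<close>. What remains is that the sequence of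
  derivatives is again compatible with the bonding maps. It is a limit of difference quotients of
  \<open>\<phi>\<close>, which are compatible, and compatibility is a closed condition. The argument applies to any
  space with continuous linear maps to the local spaces, hence also to the differential on \<open>U \<times> E\<close>,
  which gives all orders by induction.\<close>

section \<open>Normed spaces with explicit carrier\<close>

text \<open>Condition (iii) speaks only about threads in \<open>Ulim\<close>, and the projections of
  \<open>Ulim\<close> need not fill the sets \<open>U n\<close>. So no identity between the maps
  \<open>\<phi> n\<close> on open subsets of the local spaces is given that a chain rule could
  differentiate. The substitute is the openness of \<open>Ulim\<close>: the point
  \<open>x + t v\<close> stays in it for small \<open>t\<close>, and compatibility at
  \<open>x\<close> and at \<open>x + t v\<close> compares the difference quotients on two levels.
  One direction at a time is enough, because compatibility of the derivatives is an identity for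
  each fixed \<open>v\<close>.

  The same obstacle returns at every order, since the differentials are again compatible only along
  the points of \<open>U \<times> E\<close>. The induction therefore carries compatibility at the
  points of an open set, transported by linear maps \<open>\<pi> n\<close> to the local spaces. One
  step replaces each space by its square, \<open>V n\<close> by its product with the whole local
  space, \<open>\<pi> n\<close> by two copies of itself, and the map on level \<open>n\<close> by
  its uncurried differential.\<close>

locale seminormed_carrier =
  fixes E :: "'a nspace"
  assumes zero_closed [simp]: "vzero E \<in> vcarrier E"
    and add_closed [simp]: "\<lbrakk>x \<in> vcarrier E; y \<in> vcarrier E\<rbrakk> \<Longrightarrow> vadd E x y \<in> vcarrier E"
    and scale_closed [simp]: "x \<in> vcarrier E \<Longrightarrow> vscale E c x \<in> vcarrier E"
    and add_assoc: "\<lbrakk>x \<in> vcarrier E; y \<in> vcarrier E; z \<in> vcarrier E\<rbrakk>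
      \<Longrightarrow> vadd E (vadd E x y) z = vadd E x (vadd E y z)"
    and add_commute: "\<lbrakk>x \<in> vcarrier E; y \<in> vcarrier E\<rbrakk> \<Longrightarrow> vadd E x y = vadd E y x"
    and add_zero [simp]: "x \<in> vcarrier E \<Longrightarrow> vadd E x (vzero E) = x"
    and scale_add: "\<lbrakk>x \<in> vcarrier E; y \<in> vcarrier E\<rbrakk>
      \<Longrightarrow> vscale E c (vadd E x y) = vadd E (vscale E c x) (vscale E c y)"
    and add_scale: "x \<in> vcarrier E \<Longrightarrow> vadd E (vscale E b x) (vscale E c x) = vscale E (b + c) x"
    and scale_scale [simp]: "x \<in> vcarrier E \<Longrightarrow> vscale E b (vscale E c x) = vscale E (b * c) x"
    and scale_one [simp]: "x \<in> vcarrier E \<Longrightarrow> vscale E 1 x = x"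
    and scale_zero [simp]: "x \<in> vcarrier E \<Longrightarrow> vscale E 0 x = vzero E"
    and norm_triangle: "\<lbrakk>x \<in> vcarrier E; y \<in> vcarrier E\<rbrakk>
      \<Longrightarrow> vnorm E (vadd E x y) \<le> vnorm E x + vnorm E y"
    and norm_scale: "x \<in> vcarrier E \<Longrightarrow> vnorm E (vscale E c x) = \<bar>c\<bar> * vnorm E x"

text \<open>Separation is split off because it fails in general for a vector space with a single
  seminorm and for Cauchy sequences with the limit of the norms; both still satisfy the axioms
  above.\<close>

locale normed_carrier = seminormed_carrier +
  assumes norm_zero_imp: "\<lbrakk>x \<in> vcarrier E; vnorm E x = 0\<rbrakk> \<Longrightarrow> x = vzero E"

context seminormed_carrier
begin

lemma add_left_commute:
  "\<lbrakk>x \<in> vcarrier E; y \<in> vcarrier E; z \<in> vcarrier E\<rbrakk>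
    \<Longrightarrow> vadd E x (vadd E y z) = vadd E y (vadd E x z)"
  by (metis add_assoc add_commute)

lemma zero_add [simp]: "x \<in> vcarrier E \<Longrightarrow> vadd E (vzero E) x = x"
  by (metis add_commute add_zero zero_closed)

lemma scale_zero_right [simp]: "vscale E c (vzero E) = vzero E"
  by (metis mult_zero_right scale_scale scale_zero zero_closed)

lemma norm_zero [simp]: "vnorm E (vzero E) = 0"
  by (metis abs_zero mult_zero_left norm_scale scale_zero zero_closed)

lemma minus_closed [simp]:
  "\<lbrakk>x \<in> vcarrier E; y \<in> vcarrier E\<rbrakk> \<Longrightarrow> vminus E x y \<in> vcarrier E"
  by (simp add: vminus_def)

lemma minus_zero [simp]: "x \<in> vcarrier E \<Longrightarrow> vminus E x (vzero E) = x"
  by (simp add: vminus_def)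

lemma minus_self [simp]: "x \<in> vcarrier E \<Longrightarrow> vminus E x x = vzero E"
  using add_scale[of x 1 "-1"] by (simp add: vminus_def)

text \<open>The triangle inequality for \<open>x\<close> and \<open>-x\<close> gives
  \<open>0 \<le> 2 * vnorm E x\<close>.\<close>

lemma norm_nonneg: "x \<in> vcarrier E \<Longrightarrow> 0 \<le> vnorm E x"
  using norm_triangle[of x "vscale E (-1) x"] norm_scale[of x "-1"] minus_self[of x]
  by (simp add: vminus_def)

lemma minus_add_minus:
  assumes "x \<in> vcarrier E" "y \<in> vcarrier E" "z \<in> vcarrier E"
  shows "vadd E (vminus E x y) (vminus E y z) = vminus E x z"
proof -
  have "vadd E (vminus E x y) (vminus E y z)
      = vadd E (vminus E y y) (vminus E x z)"
    using assms by (simp add: vminus_def add_assoc add_commute add_left_commute)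
  then show ?thesis using assms by simp
qed

lemma add_minus_add:
  assumes "x \<in> vcarrier E" "y \<in> vcarrier E" "x' \<in> vcarrier E" "y' \<in> vcarrier E"
  shows "vminus E (vadd E x y) (vadd E x' y') = vadd E (vminus E x x') (vminus E y y')"
  using assms by (simp add: vminus_def scale_add add_assoc add_commute add_left_commute)

lemma scale_minus:
  assumes "x \<in> vcarrier E" "y \<in> vcarrier E"
  shows "vscale E c (vminus E x y) = vminus E (vscale E c x) (vscale E c y)"
  using assms by (simp add: vminus_def scale_add)

lemma minus_scale:
  assumes "x \<in> vcarrier E"
  shows "vminus E (vscale E b x) (vscale E c x) = vscale E (b - c) x"
  using assms add_scale[of x b "-c"] by (simp add: vminus_def)

lemma norm_minus_commute:
  assumes "x \<in> vcarrier E" "y \<in> vcarrier E"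
  shows "vnorm E (vminus E x y) = vnorm E (vminus E y x)"
proof -
  have "vminus E y x = vscale E (-1) (vminus E x y)"
    using assms by (simp add: vminus_def scale_add add_commute)
  then show ?thesis using assms by (simp add: norm_scale)
qed

lemma norm_minus_triangle:
  assumes "x \<in> vcarrier E" "y \<in> vcarrier E" "z \<in> vcarrier E"
  shows "vnorm E (vminus E x z) \<le> vnorm E (vminus E x y) + vnorm E (vminus E y z)"
  using norm_triangle[of "vminus E x y" "vminus E y z"] assms
  by (simp add: minus_add_minus)

lemma norm_le_minus:
  assumes "x \<in> vcarrier E" "y \<in> vcarrier E"
  shows "\<bar>vnorm E x - vnorm E y\<bar> \<le> vnorm E (vminus E x y)"
proof -
  have "vnorm E x \<le> vnorm E (vminus E x y) + vnorm E y"
    using norm_minus_triangle[of x y "vzero E"] assms by simp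
  moreover have "vnorm E y \<le> vnorm E (vminus E y x) + vnorm E x"
    using norm_minus_triangle[of y x "vzero E"] assms by simp
  ultimately show ?thesis
    using norm_minus_commute[OF assms] by linarith
qed

end

context normed_carrier
begin

lemma norm_minus_eq_0_iff [simp]:
  assumes "x \<in> vcarrier E" "y \<in> vcarrier E"
  shows "vnorm E (vminus E x y) = 0 \<longleftrightarrow> x = y"
proof
  assume "vnorm E (vminus E x y) = 0"
  then have *: "vminus E x y = vzero E" using norm_zero_imp assms by simp
  have "vadd E (vminus E x y) y = vadd E x (vminus E y y)"
    using assms by (simp add: vminus_def add_assoc add_commute add_left_commute)
  then show "x = y" using assms * by simp
qed (use assms in auto)

lemma Metric_space: "Metric_space (vcarrier E) (ndist E)"
  by unfold_locales
    (auto simp: ndist_def norm_nonneg norm_minus_commute intro: norm_minus_triangle)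

lemma topspace_ntopo [simp]: "topspace (ntopo E) = vcarrier E"
  by (simp add: ntopo_def Metric_space.topspace_mtopology[OF Metric_space])

lemma ndist_eq: "\<lbrakk>x \<in> vcarrier E; y \<in> vcarrier E\<rbrakk> \<Longrightarrow> ndist E x y = vnorm E (vminus E x y)"
  by (simp add: ndist_def)

lemma norm_eq_ndist: "x \<in> vcarrier E \<Longrightarrow> vnorm E x = ndist E x (vzero E)"
  by (simp add: ndist_def)

lemma ndist_add_le:
  assumes "x \<in> vcarrier E" "y \<in> vcarrier E" "x' \<in> vcarrier E" "y' \<in> vcarrier E"
  shows "ndist E (vadd E x y) (vadd E x' y') \<le> ndist E x x' + ndist E y y'"
  using assms by (simp add: ndist_eq add_minus_add norm_triangle)

lemma ndist_scale:
  assumes "x \<in> vcarrier E" "y \<in> vcarrier E"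
  shows "ndist E (vscale E c x) (vscale E c y) = \<bar>c\<bar> * ndist E x y"
  using assms by (simp add: ndist_eq norm_scale flip: scale_minus)

end

text \<open>Quotients and completions are both images of a seminormed space (all vectors,
  respectively all Cauchy sequences) on which vectors at distance zero are identified.\<close>

lemma (in seminormed_carrier) normed_carrier_image:
  fixes F :: "'b nspace"
  assumes im: "vcarrier F = \<pi> ` vcarrier E"
    and zero: "vzero F = \<pi> (vzero E)"
    and add: "\<And>x y. \<lbrakk>x \<in> vcarrier E; y \<in> vcarrier E\<rbrakk> \<Longrightarrow> vadd F (\<pi> x) (\<pi> y) = \<pi> (vadd E x y)"
    and scale: "\<And>c x. x \<in> vcarrier E \<Longrightarrow> vscale F c (\<pi> x) = \<pi> (vscale E c x)"
    and norm: "\<And>x. x \<in> vcarrier E \<Longrightarrow> vnorm F (\<pi> x) = vnorm E x"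
    and eq: "\<And>x. \<lbrakk>x \<in> vcarrier E; vnorm E x = 0\<rbrakk> \<Longrightarrow> \<pi> x = \<pi> (vzero E)"
  shows "normed_carrier F"
proof unfold_locales
  show "vadd F x y = vadd F y x" if "x \<in> vcarrier F" "y \<in> vcarrier F" for x y
    using that add_commute by (auto simp: im add)
  show "x = vzero F" if "x \<in> vcarrier F" "vnorm F x = 0" for x
    using that by (metis im imageE eq norm zero)
qed (auto simp: im zero add scale norm norm_triangle norm_scale add_assoc scale_add add_scale)

section \<open>Quotients and completions\<close>

lemma seminorm_diff: "seminorm p \<Longrightarrow> p (x - y) = p (y - x)"
  unfolding seminorm_def
  by (metis abs_minus_cancel abs_one minus_diff_eq mult_1 scaleR_minus1_left)

lemma seminorm_zero: "seminorm p \<Longrightarrow> p 0 = 0"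
  unfolding seminorm_def by (metis abs_zero mult_zero_left scaleR_zero_left)

lemma seminorm_eq_iff_zero_dist:
  assumes "seminorm p" "p (x - y) = 0"
  shows "p x = p y"
proof -
  have "p x \<le> p (x - y) + p y" "p y \<le> p (y - x) + p x"
    using assms(1) unfolding seminorm_def by (metis diff_add_cancel)+
  then show ?thesis using assms seminorm_diff[OF assms(1), of x y] by linarith
qed

lemma mem_ker_coset: "y \<in> ker_coset p x \<longleftrightarrow> p (y - x) = 0"
  by (force simp: ker_coset_def image_iff)

lemma ker_coset_eq:
  assumes "seminorm p" "p (x - y) = 0"
  shows "ker_coset p x = ker_coset p y"
proof -
  have "p (z - x) = 0 \<longleftrightarrow> p (z - y) = 0" for z
    using seminorm_eq_iff_zero_dist[OF assms(1), of "z - x" "z - y"] assms(2)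
      seminorm_diff[OF assms(1), of x y] by simp
  then show ?thesis by (auto simp: mem_ker_coset)
qed

lemma mem_ker_coset_self: "seminorm p \<Longrightarrow> x \<in> ker_coset p x"
  by (simp add: mem_ker_coset seminorm_zero)

lemma ker_coset_cong_mono:
  assumes p: "seminorm p" and le: "\<And>x. p x \<le> q x" and y: "y \<in> ker_coset q x"
  shows "ker_coset p y = ker_coset p x"
proof (rule ker_coset_eq[OF p])
  \<comment> \<open>\<open>seminorm\<close> does not list nonnegativity. It comes from
    \<open>0 = p 0 \<le> p z + p (- z) = 2 * p z\<close>, and together with \<open>p \<le> q\<close>
    it squeezes \<open>p (y - x)\<close> to 0.\<close>
  have "p (y - x) + p (y - x) \<ge> 0"
    using p seminorm_zero[OF p] seminorm_diff[OF p] unfolding seminorm_def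
    by (metis add.right_inverse minus_diff_eq)
  then show "p (y - x) = 0"
    using y le[of "y - x"] by (simp add: mem_ker_coset)
qed

text \<open>Evaluates the map between quotients whose extension to the completions is
  \<open>bond\<close>: the kernel of the larger seminorm is the smaller one, so all cosets in the
  union coincide.\<close>

lemma Union_ker_coset:
  assumes "seminorm p" "\<And>x. p x \<le> q x" "seminorm q"
  shows "(\<Union>a\<in>ker_coset q x. ker_coset p a) = ker_coset p x"
  using ker_coset_cong_mono[OF assms(1,2)] mem_ker_coset_self[OF assms(3)] by blast

text \<open>The operations of \<open>quotient_space\<close> are unions over all representatives.
  Since every choice of representatives contributes the same coset, the union collapses to a single
  one; scaling follows the same pattern, and the norm is constant on a coset.\<close>

lemma quotient_space_add:
  assumes p: "seminorm p"
  shows "vadd (quotient_space p) (ker_coset p x) (ker_coset p y) = ker_coset p (x + y)"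
proof -
  have "ker_coset p (a + b) = ker_coset p (x + y)"
    if "a \<in> ker_coset p x" "b \<in> ker_coset p y" for a b
  proof (rule ker_coset_eq[OF p])
    have "p ((a + b) - (x + b)) = 0" "p ((x + b) - (x + y)) = 0"
      using that by (simp_all add: mem_ker_coset)
    then show "p ((a + b) - (x + y)) = 0"
      using ker_coset_eq[OF p] mem_ker_coset by blast
  qed
  then have "(\<Union>b\<in>ker_coset p y. ker_coset p (a + b)) = ker_coset p (x + y)"
    if "a \<in> ker_coset p x" for a
    using that UN_constant_eq[OF mem_ker_coset_self[OF p]] by (metis (no_types, lifting))
  then show ?thesis
    using mem_ker_coset_self[OF p, of x] by (auto simp: quotient_space_def)
qed

lemma quotient_space_scale:
  assumes p: "seminorm p"
  shows "vscale (quotient_space p) c (ker_coset p x) = ker_coset p (c *\<^sub>R x)"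
proof -
  have "ker_coset p (c *\<^sub>R a) = ker_coset p (c *\<^sub>R x)" if "a \<in> ker_coset p x" for a
  proof (rule ker_coset_eq[OF p])
    show "p (c *\<^sub>R a - c *\<^sub>R x) = 0"
      using that p by (simp add: mem_ker_coset seminorm_def flip: scaleR_diff_right)
  qed
  then have "(\<Union>a\<in>ker_coset p x. ker_coset p (c *\<^sub>R a)) = ker_coset p (c *\<^sub>R x)"
    by (intro UN_constant_eq[OF mem_ker_coset_self[OF p]] ballI)
  then show ?thesis by (simp add: quotient_space_def)
qed

lemma quotient_space_norm:
  assumes p: "seminorm p"
  shows "vnorm (quotient_space p) (ker_coset p x) = p x"
proof -
  have "p ` ker_coset p x = {p x}"
  proof (intro equalityI image_subsetI)
    show "p y \<in> {p x}" if "y \<in> ker_coset p x" for y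
      using that seminorm_eq_iff_zero_dist[OF p] by (simp add: mem_ker_coset)
  qed (simp add: mem_ker_coset_self[OF p])
  then show ?thesis by (simp add: quotient_space_def)
qed

lemma quotient_space_carrier: "vcarrier (quotient_space p) = range (ker_coset p)"
  by (simp add: quotient_space_def)

lemma normed_carrier_quotient_space:
  assumes p: "seminorm p"
  shows "normed_carrier (quotient_space p)"
proof -
  let ?G = "\<lparr>vcarrier = UNIV, vzero = 0, vadd = (+), vscale = (*\<^sub>R), vnorm = p\<rparr>"
  interpret seminormed_carrier ?G
    using p by unfold_locales (auto simp: seminorm_def algebra_simps)
  show ?thesis
  proof (rule normed_carrier_image[where \<pi> = "ker_coset p"])
    show "ker_coset p x = ker_coset p (vzero ?G)" if "vnorm ?G x = 0" for x
      using that ker_coset_eq[OF p, of x 0] by simp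
  qed (simp_all add: quotient_space_add quotient_space_scale quotient_space_norm p
        quotient_space_carrier, simp add: quotient_space_def)
qed

section \<open>Cauchy sequences and the completion of a normed space\<close>

context normed_carrier
begin

lemma mem_ncauchy:
  "x \<in> ncauchy E \<longleftrightarrow> (\<forall>k. x k \<in> vcarrier E) \<and>
     (\<forall>e>0. \<exists>N. \<forall>m n. N \<le> m \<longrightarrow> N \<le> n \<longrightarrow> ndist E (x m) (x n) < e)"
  by (auto simp: ncauchy_def Metric_space.MCauchy_def[OF Metric_space])

lemma ncauchyI:
  assumes "\<And>k. x k \<in> vcarrier E"
    and "\<And>e. e > 0 \<Longrightarrow> \<exists>N. \<forall>m n. N \<le> m \<longrightarrow> N \<le> n \<longrightarrow> ndist E (x m) (x n) < e"
  shows "x \<in> ncauchy E"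
  using assms unfolding mem_ncauchy by blast

lemma ncauchy_closed: "x \<in> ncauchy E \<Longrightarrow> x k \<in> vcarrier E"
  by (simp add: mem_ncauchy)

lemma ncauchyD:
  assumes "x \<in> ncauchy E" "e > 0"
  obtains N where "\<And>m n. \<lbrakk>N \<le> m; N \<le> n\<rbrakk> \<Longrightarrow> ndist E (x m) (x n) < e"
  using assms unfolding mem_ncauchy by meson

lemma ncauchy_const [simp]: "a \<in> vcarrier E \<Longrightarrow> (\<lambda>k. a) \<in> ncauchy E"
  by (simp add: mem_ncauchy ndist_eq)

lemma ncauchy_add:
  assumes x: "x \<in> ncauchy E" and y: "y \<in> ncauchy E"
  shows "(\<lambda>k. vadd E (x k) (y k)) \<in> ncauchy E"
proof (rule ncauchyI)
  fix e :: real assume "e > 0"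
  then have e: "e / 2 > 0" by simp
  obtain M where M: "\<And>m n. \<lbrakk>M \<le> m; M \<le> n\<rbrakk> \<Longrightarrow> ndist E (x m) (x n) < e / 2"
    using ncauchyD[OF x e] by blast
  obtain N where N: "\<And>m n. \<lbrakk>N \<le> m; N \<le> n\<rbrakk> \<Longrightarrow> ndist E (y m) (y n) < e / 2"
    using ncauchyD[OF y e] by blast
  have "ndist E (vadd E (x m) (y m)) (vadd E (x n) (y n)) < e"
    if "max M N \<le> m" "max M N \<le> n" for m n
    using ndist_add_le[of "x m" "y m" "x n" "y n"] M[of m n] N[of m n] that
    by (simp add: ncauchy_closed x y)
  then show "\<exists>N. \<forall>m n. N \<le> m \<longrightarrow> N \<le> n \<longrightarrow>
      ndist E (vadd E (x m) (y m)) (vadd E (x n) (y n)) < e" by blast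
qed (simp add: ncauchy_closed x y)

lemma ncauchy_Lipschitz:
  fixes F :: "'b nspace"
  assumes F: "normed_carrier F" and x: "x \<in> ncauchy E" and C: "0 \<le> C"
    and f: "\<And>a. a \<in> vcarrier E \<Longrightarrow> f a \<in> vcarrier F"
    and le: "\<And>a b. \<lbrakk>a \<in> vcarrier E; b \<in> vcarrier E\<rbrakk> \<Longrightarrow> ndist F (f a) (f b) \<le> C * ndist E a b"
  shows "(\<lambda>k. f (x k)) \<in> ncauchy F"
proof (rule normed_carrier.ncauchyI[OF F])
  fix e :: real assume "e > 0"
  \<comment> \<open>Division by \<open>C + 1\<close> instead of \<open>C\<close>, since
    \<open>C = 0\<close> is allowed.\<close>
  then have "e / (C + 1) > 0" using C by simp
  then obtain N where N: "\<And>m n. \<lbrakk>N \<le> m; N \<le> n\<rbrakk> \<Longrightarrow> ndist E (x m) (x n) < e / (C + 1)"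
    using ncauchyD[OF x] by blast
  have "ndist F (f (x m)) (f (x n)) < e" if "N \<le> m" "N \<le> n" for m n
  proof -
    have "ndist F (f (x m)) (f (x n)) \<le> C * ndist E (x m) (x n)"
      by (rule le) (simp_all add: ncauchy_closed x)
    also have "\<dots> \<le> (C + 1) * ndist E (x m) (x n)"
      using Metric_space.nonneg[OF Metric_space] by (simp add: mult_right_mono)
    also have "\<dots> < e" using N[OF that] C by (simp add: field_simps)
    finally show ?thesis .
  qed
  then show "\<exists>N. \<forall>m n. N \<le> m \<longrightarrow> N \<le> n \<longrightarrow> ndist F (f (x m)) (f (x n)) < e" by blast
qed (simp add: ncauchy_closed x f)

lemma ncauchy_scale: "x \<in> ncauchy E \<Longrightarrow> (\<lambda>k. vscale E c (x k)) \<in> ncauchy E"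
  using ncauchy_Lipschitz[OF normed_carrier_axioms, of x "\<bar>c\<bar>" "vscale E c"]
  by (simp add: ndist_scale)

lemma ncauchy_norm_convergent:
  assumes "x \<in> ncauchy E"
  shows "convergent (\<lambda>k. vnorm E (x k))"
proof -
  have "Cauchy (\<lambda>k. vnorm E (x k))"
  proof (rule metric_CauchyI)
    fix e :: real assume "e > 0"
    then obtain N where N: "\<And>m n. \<lbrakk>N \<le> m; N \<le> n\<rbrakk> \<Longrightarrow> ndist E (x m) (x n) < e"
      using ncauchyD[OF assms] by blast
    have "dist (vnorm E (x m)) (vnorm E (x n)) \<le> ndist E (x m) (x n)" for m n
      using norm_le_minus[of "x m" "x n"] by (simp add: dist_real_def ndist_eq ncauchy_closed assms)
    then show "\<exists>M. \<forall>m\<ge>M. \<forall>n\<ge>M. dist (vnorm E (x m)) (vnorm E (x n)) < e"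
      using N le_less_trans by blast
  qed
  then show ?thesis by (rule Cauchy_convergent)
qed

lemma lim_norm:
  "x \<in> ncauchy E \<Longrightarrow> (\<lambda>k. vnorm E (x k)) \<longlonglongrightarrow> lim (\<lambda>k. vnorm E (x k))"
  using ncauchy_norm_convergent convergent_LIMSEQ_iff by blast

lemma null_rel_iff:
  "(x, y) \<in> null_rel E \<longleftrightarrow> x \<in> ncauchy E \<and> y \<in> ncauchy E \<and> (\<lambda>k. ndist E (x k) (y k)) \<longlonglongrightarrow> 0"
  by (simp add: null_rel_def)

lemma equiv_null_rel: "equiv (ncauchy E) (null_rel E)"
proof (rule equivI)
  show "null_rel E \<subseteq> ncauchy E \<times> ncauchy E" by (auto simp: null_rel_iff)
  show "refl_on (ncauchy E) (null_rel E)"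
    by (auto simp: refl_on_def null_rel_iff ndist_eq ncauchy_closed)
  show "sym (null_rel E)"
    by (auto simp: sym_def null_rel_iff Metric_space.commute[OF Metric_space])
  show "trans (null_rel E)"
  proof (rule transI)
    fix x y z assume xy: "(x, y) \<in> null_rel E" and yz: "(y, z) \<in> null_rel E"
    have "(\<lambda>k. ndist E (x k) (z k)) \<longlonglongrightarrow> 0"
    proof (rule Lim_null_comparison)
      show "\<forall>\<^sub>F k in sequentially. norm (ndist E (x k) (z k)) \<le> ndist E (x k) (y k) + ndist E (y k) (z k)"
        using xy yz Metric_space.triangle[OF Metric_space] Metric_space.nonneg[OF Metric_space]
        by (simp add: null_rel_iff ncauchy_closed)
      show "(\<lambda>k. ndist E (x k) (y k) + ndist E (y k) (z k)) \<longlonglongrightarrow> 0"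
        using xy yz tendsto_add_zero by (auto simp: null_rel_iff)
    qed
    then show "(x, z) \<in> null_rel E" using xy yz by (simp add: null_rel_iff)
  qed
qed

abbreviation ccls :: "(nat \<Rightarrow> 'a) \<Rightarrow> (nat \<Rightarrow> 'a) set" where
  "ccls x \<equiv> null_rel E `` {x}"

lemma mem_ccls_self: "x \<in> ncauchy E \<Longrightarrow> x \<in> ccls x"
  using equiv_class_self[OF equiv_null_rel] .

lemma ccls_eqI: "(x, y) \<in> null_rel E \<Longrightarrow> ccls x = ccls y"
  using equiv_class_eq[OF equiv_null_rel] .

text \<open>Collapses the unions over representatives by which \<open>ncompletion\<close> and
  \<open>completion_map\<close> are defined.\<close>

lemma ccls_Union_const:
  assumes "x \<in> ncauchy E" "\<And>x'. (x, x') \<in> null_rel E \<Longrightarrow> f x' = f x"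
  shows "(\<Union>x'\<in>ccls x. f x') = f x"
  using assms mem_ccls_self[OF assms(1)] by blast

lemma ncompletion_carrier: "vcarrier (ncompletion E) = ccls ` ncauchy E"
  by (auto simp: ncompletion_def quotient_def)

lemma ncompletion_add:
  assumes "x \<in> ncauchy E" "y \<in> ncauchy E"
  shows "vadd (ncompletion E) (ccls x) (ccls y) = ccls (\<lambda>k. vadd E (x k) (y k))"
proof -
  have *: "ccls (\<lambda>k. vadd E (x' k) (y' k)) = ccls (\<lambda>k. vadd E (x k) (y k))"
    if "(x, x') \<in> null_rel E" "(y, y') \<in> null_rel E" for x' y'
  proof (rule sym, rule ccls_eqI)
    have "(\<lambda>k. ndist E (vadd E (x k) (y k)) (vadd E (x' k) (y' k))) \<longlonglongrightarrow> 0"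
    proof (rule Lim_null_comparison)
      show "\<forall>\<^sub>F k in sequentially. norm (ndist E (vadd E (x k) (y k)) (vadd E (x' k) (y' k)))
          \<le> ndist E (x k) (x' k) + ndist E (y k) (y' k)"
        using that Metric_space.nonneg[OF Metric_space]
        by (simp add: null_rel_iff ncauchy_closed ndist_add_le)
      show "(\<lambda>k. ndist E (x k) (x' k) + ndist E (y k) (y' k)) \<longlonglongrightarrow> 0"
        using that tendsto_add_zero by (auto simp: null_rel_iff)
    qed
    then show "(\<lambda>k. vadd E (x k) (y k), \<lambda>k. vadd E (x' k) (y' k)) \<in> null_rel E"
      using that by (simp add: null_rel_iff ncauchy_add)
  qed
  have "(\<Union>x'\<in>ccls x. \<Union>y'\<in>ccls y. ccls (\<lambda>k. vadd E (x' k) (y' k)))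
      = ccls (\<lambda>k. vadd E (x k) (y k))"
    using * mem_ccls_self[OF assms(1)] mem_ccls_self[OF assms(2)] by blast
  then show ?thesis by (simp add: ncompletion_def)
qed

lemma ncompletion_scale:
  assumes "x \<in> ncauchy E"
  shows "vscale (ncompletion E) c (ccls x) = ccls (\<lambda>k. vscale E c (x k))"
proof -
  have "ccls (\<lambda>k. vscale E c (x' k)) = ccls (\<lambda>k. vscale E c (x k))"
    if "(x, x') \<in> null_rel E" for x'
  proof (rule sym, rule ccls_eqI)
    have "(\<lambda>k. \<bar>c\<bar> * ndist E (x k) (x' k)) \<longlonglongrightarrow> 0"
      using that tendsto_mult_right_zero by (auto simp: null_rel_iff)
    then show "(\<lambda>k. vscale E c (x k), \<lambda>k. vscale E c (x' k)) \<in> null_rel E"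
      using that by (simp add: null_rel_iff ncauchy_scale ndist_scale ncauchy_closed)
  qed
  then have "(\<Union>x'\<in>ccls x. ccls (\<lambda>k. vscale E c (x' k))) = ccls (\<lambda>k. vscale E c (x k))"
    by (rule ccls_Union_const[OF assms])
  then show ?thesis by (simp add: ncompletion_def)
qed

text \<open>By the reverse triangle inequality the norms along two equivalent sequences differ by a
  null sequence, so \<open>the_elem\<close> in the definition is applied to a singleton.\<close>

lemma ncompletion_norm:
  assumes "x \<in> ncauchy E"
  shows "vnorm (ncompletion E) (ccls x) = lim (\<lambda>k. vnorm E (x k))"
proof -
  have "lim (\<lambda>k. vnorm E (x' k)) = lim (\<lambda>k. vnorm E (x k))" if "(x, x') \<in> null_rel E" for x'
  proof -
    have "(\<lambda>k. vnorm E (x k) - vnorm E (x' k)) \<longlonglongrightarrow> 0"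
    proof (rule Lim_null_comparison)
      show "\<forall>\<^sub>F k in sequentially. norm (vnorm E (x k) - vnorm E (x' k)) \<le> ndist E (x k) (x' k)"
        using that by (simp add: null_rel_iff ncauchy_closed norm_le_minus ndist_eq)
      show "(\<lambda>k. ndist E (x k) (x' k)) \<longlonglongrightarrow> 0"
        using that by (simp add: null_rel_iff)
    qed
    then have "(\<lambda>k. vnorm E (x k) - (vnorm E (x k) - vnorm E (x' k)))
        \<longlonglongrightarrow> lim (\<lambda>k. vnorm E (x k)) - 0"
      using lim_norm[OF assms] tendsto_diff by blast
    then show ?thesis by (simp add: limI)
  qed
  then have "(\<lambda>x. lim (\<lambda>k. vnorm E (x k))) ` ccls x = {lim (\<lambda>k. vnorm E (x k))}"
  proof (intro equalityI image_subsetI)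
    show "{lim (\<lambda>k. vnorm E (x k))} \<subseteq> (\<lambda>x. lim (\<lambda>k. vnorm E (x k))) ` ccls x"
      using mem_ccls_self[OF assms] by blast
  qed blast
  then show ?thesis by (simp add: ncompletion_def)
qed

lemma normed_carrier_ncompletion: "normed_carrier (ncompletion E)"
proof -
  let ?G = "\<lparr>vcarrier = ncauchy E, vzero = \<lambda>k. vzero E, vadd = \<lambda>x y k. vadd E (x k) (y k),
    vscale = \<lambda>c x k. vscale E c (x k), vnorm = \<lambda>x. lim (\<lambda>k. vnorm E (x k))\<rparr>"
  have mem: "x k \<in> vcarrier E" if "x \<in> ncauchy E" for x k
    using that by (rule ncauchy_closed)
  interpret G: seminormed_carrier ?G
  proof unfold_locales
    fix x y assume xy: "x \<in> vcarrier ?G" "y \<in> vcarrier ?G"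
    show "vnorm ?G (vadd ?G x y) \<le> vnorm ?G x + vnorm ?G y"
      using xy lim_norm[OF ncauchy_add[of x y]] tendsto_add[OF lim_norm[of x] lim_norm[of y]]
      by (auto intro!: LIMSEQ_le norm_triangle mem)
  next
    fix x c assume x: "x \<in> vcarrier ?G"
    then have "(\<lambda>k. vnorm E (vscale E c (x k))) \<longlonglongrightarrow> \<bar>c\<bar> * lim (\<lambda>k. vnorm E (x k))"
      using tendsto_mult_left[OF lim_norm[of x]] by (simp add: norm_scale mem)
    then show "vnorm ?G (vscale ?G c x) = \<bar>c\<bar> * vnorm ?G x"
      by (simp add: limI)
  next
    show "vadd ?G x y = vadd ?G y x" if "x \<in> vcarrier ?G" "y \<in> vcarrier ?G" for x y
      using that by (auto simp: mem fun_eq_iff intro: add_commute)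
  qed (simp_all add: fun_eq_iff mem ncauchy_add ncauchy_scale add_assoc scale_add add_scale)
  show ?thesis
  proof (rule G.normed_carrier_image[where \<pi> = ccls])
    fix x assume x: "x \<in> vcarrier ?G" "vnorm ?G x = 0"
    show "ccls x = ccls (vzero ?G)"
    proof (rule ccls_eqI)
      show "(x, vzero ?G) \<in> null_rel E"
        using x lim_norm[of x] by (simp add: null_rel_iff ndist_eq mem)
    qed
  qed (simp_all add: ncompletion_carrier ncompletion_add ncompletion_scale ncompletion_norm,
      simp add: ncompletion_def)
qed

end

section \<open>Continuity\<close>

text \<open>The sources below are projective limits, products and subspaces without a chosen metric,
  while the targets that are tested are metric. Hence the mixture of open neighbourhoods in the
  source with an epsilon in the target.\<close>

lemma (in Metric_space) topcontinuous_at_mtopology_iff: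
  "topcontinuous_at X mtopology f x \<longleftrightarrow>
     x \<in> topspace X \<and> f \<in> topspace X \<rightarrow> M \<and>
     (\<forall>e>0. \<exists>U. openin X U \<and> x \<in> U \<and> (\<forall>y\<in>U. d (f x) (f y) < e))"
  (is "?L \<longleftrightarrow> ?R")
proof
  assume L: ?L
  then have fM: "f \<in> topspace X \<rightarrow> M" and x: "x \<in> topspace X"
    by (auto simp: topcontinuous_at_def)
  have "\<exists>U. openin X U \<and> x \<in> U \<and> (\<forall>y\<in>U. d (f x) (f y) < e)" if "e > 0" for e
  proof -
    have "openin mtopology (mball (f x) e)" "f x \<in> mball (f x) e"
      using that fM x by (auto simp: Pi_iff)
    then obtain U where "openin X U" "x \<in> U" "\<forall>y\<in>U. f y \<in> mball (f x) e"
      using L unfolding topcontinuous_at_def by meson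
    then show ?thesis by auto
  qed
  then show ?R using fM x by blast
next
  assume R: ?R
  have "\<exists>U. openin X U \<and> x \<in> U \<and> (\<forall>y\<in>U. f y \<in> V)" if V: "openin mtopology V" "f x \<in> V" for V
  proof -
    obtain e where "e > 0" and e: "mball (f x) e \<subseteq> V"
      using V by (meson openin_mtopology)
    then obtain U where U: "openin X U" "x \<in> U" "\<And>y. y \<in> U \<Longrightarrow> d (f x) (f y) < e"
      using R by meson
    have "f y \<in> V" if "y \<in> U" for y
    proof -
      have "y \<in> topspace X" using that U(1) openin_subset by blast
      then show ?thesis using R U(3)[OF that] e by (auto simp: Pi_iff)
    qed
    then show ?thesis using U by blast
  qed
  then show ?L using R by (simp add: topcontinuous_at_def)
qed

lemma topcontinuous_at_compose_continuous_map:
  assumes "continuous_map X Y f" "topcontinuous_at Y Z g (f x)" "x \<in> topspace X"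
  shows "topcontinuous_at X Z (\<lambda>x. g (f x)) x"
  unfolding topcontinuous_at_def
proof (intro conjI strip)
  show "(\<lambda>x. g (f x)) \<in> topspace X \<rightarrow> topspace Z"
    using assms by (force simp: topcontinuous_at_def continuous_map_def)
  fix V assume "openin Z V \<and> g (f x) \<in> V"
  then obtain W where W: "openin Y W" "f x \<in> W" "\<forall>y\<in>W. g y \<in> V"
    using assms(2) unfolding topcontinuous_at_def by meson
  then have "openin X {y \<in> topspace X. f y \<in> W}"
    using assms(1) by (simp add: continuous_map_def)
  then show "\<exists>U. openin X U \<and> x \<in> U \<and> (\<forall>y\<in>U. g (f y) \<in> V)"
    using W assms(3) by (intro exI[of _ "{y \<in> topspace X. f y \<in> W}"]) auto
qed (use assms in auto)

lemma topcontinuous_at_cong: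
  assumes "topcontinuous_at X Y f x" "\<And>y. y \<in> topspace X \<Longrightarrow> f y = g y"
  shows "topcontinuous_at X Y g x"
  unfolding topcontinuous_at_def
proof (intro conjI strip)
  show "x \<in> topspace X" and "g \<in> topspace X \<rightarrow> topspace Y"
    using assms by (auto simp: topcontinuous_at_def Pi_iff)
  fix V assume "openin Y V \<and> g x \<in> V"
  then obtain U where "openin X U" "x \<in> U" "\<forall>y\<in>U. f y \<in> V"
    using assms unfolding topcontinuous_at_def by metis
  then show "\<exists>U. openin X U \<and> x \<in> U \<and> (\<forall>y\<in>U. g y \<in> V)"
    using assms(2) by (metis openin_subset subsetD)
qed

section \<open>Initial topologies\<close>

lemma topspace_initial_topology:
  assumes "I \<noteq> {}" "\<And>i x. \<lbrakk>i \<in> I; x \<in> S\<rbrakk> \<Longrightarrow> p i x \<in> topspace (T i)"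
  shows "topspace (initial_topology S I p T) = S"
proof
  obtain i where i: "i \<in> I" using assms(1) by blast
  \<comment> \<open>A generated topology lives on the union of its subbasis. One index suffices to
    make \<open>S\<close> itself a subbasic set.\<close>
  have "S = {x \<in> S. p i x \<in> topspace (T i)}" using assms(2) i by auto
  then have "S \<in> {{x \<in> S. p i x \<in> V} |i V. i \<in> I \<and> openin (T i) V}"
    using i by blast
  then show "S \<subseteq> topspace (initial_topology S I p T)"
    unfolding initial_topology_def topology_generated_by_topspace by blast
qed (auto simp: initial_topology_def)

lemma continuous_map_initial_topology_proj:
  assumes "i \<in> I" "\<And>i x. \<lbrakk>i \<in> I; x \<in> S\<rbrakk> \<Longrightarrow> p i x \<in> topspace (T i)"
  shows "continuous_map (initial_topology S I p T) (T i) (p i)"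
proof -
  have top: "topspace (initial_topology S I p T) = S"
    using assms by (intro topspace_initial_topology) auto
  have "openin (initial_topology S I p T) {x \<in> S. p i x \<in> V}" if "openin (T i) V" for V
    unfolding initial_topology_def using that assms(1)
    by (intro topology_generated_by_Basis) blast
  then show ?thesis
    using assms by (simp add: continuous_map_def top Pi_iff)
qed

text \<open>The universal property of the initial topology, at a single point. The induction follows
  the generation of open sets; the continuity of the coordinates enters in the subbasic case, and
  the other cases combine neighbourhoods.\<close>

lemma topcontinuous_at_initial_topology:
  assumes x: "x \<in> topspace X" and f: "f \<in> topspace X \<rightarrow> S" and I: "I \<noteq> {}"
    and cont: "\<And>i. i \<in> I \<Longrightarrow> topcontinuous_at X (T i) (\<lambda>y. p i (f y)) x"
    and p: "\<And>i x. \<lbrakk>i \<in> I; x \<in> S\<rbrakk> \<Longrightarrow> p i x \<in> topspace (T i)"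
  shows "topcontinuous_at X (initial_topology S I p T) f x"
proof -
  let ?B = "{{x \<in> S. p i x \<in> V} |i V. i \<in> I \<and> openin (T i) V}"
  have "\<exists>U. openin X U \<and> x \<in> U \<and> (\<forall>y\<in>U. f y \<in> W)"
    if "generate_topology_on ?B W" "f x \<in> W" for W
    using that
  proof (induction rule: generate_topology_on.induct)
    case (Int a b)
    then obtain U U' where "openin X U" "x \<in> U" "\<forall>y\<in>U. f y \<in> a"
      "openin X U'" "x \<in> U'" "\<forall>y\<in>U'. f y \<in> b" by auto
    then show ?case by (intro exI[of _ "U \<inter> U'"]) auto
  next
    case (UN K)
    then show ?case by (meson UnionE UnionI)
  next
    case (Basis W)
    then obtain i V where "i \<in> I" "openin (T i) V" and W: "W = {x \<in> S. p i x \<in> V}" by auto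
    then obtain U where U: "openin X U" "x \<in> U" "\<forall>y\<in>U. p i (f y) \<in> V"
      using cont[of i] Basis.prems unfolding topcontinuous_at_def by auto
    have "f y \<in> W" if "y \<in> U" for y
      using that U f openin_subset[OF U(1)] by (auto simp: W)
    then show ?case using U by blast
  qed auto
  then show ?thesis
    unfolding topcontinuous_at_def
    using x f by (simp add: topspace_initial_topology[OF I p])
      (simp add: initial_topology_def openin_topology_generated_by_iff)
qed

context normed_carrier
begin

lemma topcontinuous_at_ntopo_iff:
  "topcontinuous_at X (ntopo E) f x \<longleftrightarrow>
     x \<in> topspace X \<and> f \<in> topspace X \<rightarrow> vcarrier E \<and>
     (\<forall>e>0. \<exists>U. openin X U \<and> x \<in> U \<and> (\<forall>y\<in>U. ndist E (f x) (f y) < e))"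
  unfolding ntopo_def by (rule Metric_space.topcontinuous_at_mtopology_iff[OF Metric_space])

lemma openin_ntopo_ball:
  assumes "x \<in> vcarrier E"
  shows "openin (ntopo E) {y \<in> vcarrier E. ndist E x y < e}"
  using Metric_space.openin_mball[OF Metric_space, of x e] assms
  by (simp add: ntopo_def Metric_space.mball_def[OF Metric_space])

lemma openin_ntopo_ballD:
  assumes "openin (ntopo E) U" "x \<in> U"
  obtains r where "r > 0" "\<And>y. \<lbrakk>y \<in> vcarrier E; ndist E x y < r\<rbrakk> \<Longrightarrow> y \<in> U"
proof -
  obtain r where "r > 0" "Metric_space.mball (vcarrier E) (ndist E) x r \<subseteq> U" "x \<in> vcarrier E"
    using assms Metric_space.openin_mtopology[OF Metric_space] unfolding ntopo_def by blast
  then show thesis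
    using that[of r] by (auto simp: Metric_space.mball_def[OF Metric_space])
qed

text \<open>The line is Lipschitz with constant \<open>vnorm E v\<close>. The radius divides by
  \<open>vnorm E v + 1\<close> because that constant may vanish.\<close>

lemma continuous_map_line:
  assumes x: "x \<in> vcarrier E" and v: "v \<in> vcarrier E"
  shows "continuous_map euclideanreal (ntopo E) (\<lambda>t. vadd E x (vscale E t v))"
  unfolding continuous_map_eq_topcontinuous_at
proof
  fix t :: real
  have dist: "ndist E (vadd E x (vscale E t v)) (vadd E x (vscale E t' v)) \<le> \<bar>t - t'\<bar> * vnorm E v" for t'
    using ndist_add_le[of x "vscale E t v" x "vscale E t' v"] x v
    by (simp add: ndist_eq minus_scale norm_scale)
  have "\<exists>U. openin euclideanreal U \<and> t \<in> U \<and>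
      (\<forall>y\<in>U. ndist E (vadd E x (vscale E t v)) (vadd E x (vscale E y v)) < e)" if "e > 0" for e
  proof (intro exI[of _ "ball t (e / (vnorm E v + 1))"] conjI ballI)
    have pos: "vnorm E v + 1 > 0" using norm_nonneg[OF v] by linarith
    then show "t \<in> ball t (e / (vnorm E v + 1))" using that by simp
    fix y assume y: "y \<in> ball t (e / (vnorm E v + 1))"
    have "\<bar>t - y\<bar> * vnorm E v \<le> \<bar>t - y\<bar> * (vnorm E v + 1)" by (simp add: mult_left_mono)
    also have "\<dots> < e" using y pos by (simp add: dist_real_def field_simps)
    finally show "ndist E (vadd E x (vscale E t v)) (vadd E x (vscale E y v)) < e"
      using dist[of y] by linarith
  qed auto
  then show "topcontinuous_at euclideanreal (ntopo E) (\<lambda>t. vadd E x (vscale E t v)) t"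
    using x v by (simp add: topcontinuous_at_ntopo_iff)
qed

end

section \<open>Bounded linear maps\<close>

locale normed_carrier_pair = E: normed_carrier E + F: normed_carrier F
  for E :: "'a nspace" and F :: "'b nspace"

text \<open>The bound is a parameter rather than the operator norm, because an explicit constant
  passes unchanged to completions. In this way the bonding maps inherit the constant 1 from the
  quotient maps.\<close>

locale bounded_linear_map = normed_carrier_pair E F
  for E :: "'a nspace" and F :: "'b nspace" +
  fixes f :: "'a \<Rightarrow> 'b" and C :: real
  assumes linear: "linear_between E F f"
    and C_nonneg: "0 \<le> C"
    and bound: "x \<in> vcarrier E \<Longrightarrow> vnorm F (f x) \<le> C * vnorm E x"

lemma linear_betweenD:
  assumes "linear_between E F f"
  shows "x \<in> vcarrier E \<Longrightarrow> f x \<in> vcarrier F"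
    and "\<lbrakk>x \<in> vcarrier E; y \<in> vcarrier E\<rbrakk> \<Longrightarrow> f (vadd E x y) = vadd F (f x) (f y)"
    and "x \<in> vcarrier E \<Longrightarrow> f (vscale E c x) = vscale F c (f x)"
  using assms by (auto simp: linear_between_def)

context bounded_linear_map
begin

lemmas closed [simp] = linear_betweenD(1)[OF linear]
lemmas add = linear_betweenD(2)[OF linear]
lemmas scale = linear_betweenD(3)[OF linear]

lemma minus: "\<lbrakk>x \<in> vcarrier E; y \<in> vcarrier E\<rbrakk> \<Longrightarrow> f (vminus E x y) = vminus F (f x) (f y)"
  by (simp add: vminus_def add scale)

lemma ndist_le: "\<lbrakk>x \<in> vcarrier E; y \<in> vcarrier E\<rbrakk> \<Longrightarrow> ndist F (f x) (f y) \<le> C * ndist E x y"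
  by (simp add: E.ndist_eq F.ndist_eq bound flip: minus)

lemma continuous: "continuous_map (ntopo E) (ntopo F) f"
  unfolding continuous_map_eq_topcontinuous_at
proof
  fix x assume x: "x \<in> topspace (ntopo E)"
  have "\<exists>U. openin (ntopo E) U \<and> x \<in> U \<and> (\<forall>y\<in>U. ndist F (f x) (f y) < e)" if e: "e > 0" for e
  proof (intro exI[of _ "{y \<in> vcarrier E. ndist E x y < e / (C + 1)}"] conjI ballI)
    show "openin (ntopo E) {y \<in> vcarrier E. ndist E x y < e / (C + 1)}"
      using x by (simp add: E.openin_ntopo_ball)
    show "x \<in> {y \<in> vcarrier E. ndist E x y < e / (C + 1)}"
      using x e C_nonneg by (simp add: E.ndist_eq)
    fix y assume y: "y \<in> {y \<in> vcarrier E. ndist E x y < e / (C + 1)}"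
    have "ndist F (f x) (f y) \<le> C * ndist E x y" using x y ndist_le by simp
    also have "\<dots> \<le> (C + 1) * ndist E x y"
      using Metric_space.nonneg[OF E.Metric_space] by (simp add: mult_right_mono)
    also have "\<dots> < e" using y C_nonneg by (simp add: field_simps)
    finally show "ndist F (f x) (f y) < e" .
  qed
  then show "topcontinuous_at (ntopo E) (ntopo F) f x"
    using x by (simp add: F.topcontinuous_at_ntopo_iff)
qed

lemma ncauchy_image: "x \<in> ncauchy E \<Longrightarrow> (\<lambda>k. f (x k)) \<in> ncauchy F"
  using E.ncauchy_Lipschitz[OF F.normed_carrier_axioms _ C_nonneg] by (simp add: ndist_le)

lemma null_rel_image:
  assumes "(x, y) \<in> null_rel E"
  shows "(\<lambda>k. f (x k), \<lambda>k. f (y k)) \<in> null_rel F"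
proof -
  have "(\<lambda>k. ndist F (f (x k)) (f (y k))) \<longlonglongrightarrow> 0"
  proof (rule Lim_null_comparison)
    show "\<forall>\<^sub>F k in sequentially. norm (ndist F (f (x k)) (f (y k))) \<le> C * ndist E (x k) (y k)"
      using assms Metric_space.nonneg[OF F.Metric_space]
      by (simp add: E.null_rel_iff E.ncauchy_closed ndist_le)
    show "(\<lambda>k. C * ndist E (x k) (y k)) \<longlonglongrightarrow> 0"
      using assms tendsto_mult_right_zero by (auto simp: E.null_rel_iff)
  qed
  then show ?thesis
    using assms by (simp add: F.null_rel_iff E.null_rel_iff ncauchy_image)
qed

lemma completion_map_ccls:
  assumes "x \<in> ncauchy E"
  shows "completion_map F f (E.ccls x) = F.ccls (\<lambda>k. f (x k))"
  unfolding completion_map_def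
  using E.ccls_Union_const[OF assms, of "\<lambda>x. F.ccls (\<lambda>k. f (x k))"] F.ccls_eqI null_rel_image
  by metis

lemma completion_map_bounded_linear:
  "bounded_linear_map (ncompletion E) (ncompletion F) (completion_map F f) C"
proof -
  interpret cE: normed_carrier "ncompletion E" by (rule E.normed_carrier_ncompletion)
  interpret cF: normed_carrier "ncompletion F" by (rule F.normed_carrier_ncompletion)
  show ?thesis
  proof unfold_locales
    show "linear_between (ncompletion E) (ncompletion F) (completion_map F f)"
      unfolding linear_between_def E.ncompletion_carrier F.ncompletion_carrier
      by (simp add: Pi_iff imageI completion_map_ccls E.ncompletion_add F.ncompletion_add ncauchy_image
          E.ncompletion_scale F.ncompletion_scale E.ncauchy_add E.ncauchy_scale
          E.ncauchy_closed add scale)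
    fix X assume "X \<in> vcarrier (ncompletion E)"
    then obtain x where x: "x \<in> ncauchy E" and X: "X = E.ccls x"
      by (auto simp: E.ncompletion_carrier)
    have "lim (\<lambda>k. vnorm F (f (x k))) \<le> C * lim (\<lambda>k. vnorm E (x k))"
      using F.lim_norm[OF ncauchy_image[OF x]] tendsto_mult_left[OF E.lim_norm[OF x]]
      by (rule LIMSEQ_le) (use x in \<open>auto simp: E.ncauchy_closed bound\<close>)
    then show "vnorm (ncompletion F) (completion_map F f X) \<le> C * vnorm (ncompletion E) X"
      using x by (simp add: X completion_map_ccls E.ncompletion_norm F.ncompletion_norm ncauchy_image)
  qed (rule C_nonneg)
qed

end

lemma (in normed_carrier_pair) continuous_linear_imp_bounded:
  assumes lin: "linear_between E F T" and cont: "continuous_map (ntopo E) (ntopo F) T"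
  obtains C where "bounded_linear_map E F T C"
proof -
  have T0: "T (vzero E) = vzero F"
    using linear_betweenD[OF lin] by (metis E.scale_zero E.zero_closed F.scale_zero)
  have "topcontinuous_at (ntopo E) (ntopo F) T (vzero E)"
    using cont by (simp add: continuous_map_eq_topcontinuous_at)
  then obtain U where U: "openin (ntopo E) U" "vzero E \<in> U"
    "\<And>y. y \<in> U \<Longrightarrow> ndist F (T (vzero E)) (T y) < 1"
    unfolding F.topcontinuous_at_ntopo_iff using zero_less_one by metis
  obtain r where r: "r > 0" "\<And>y. \<lbrakk>y \<in> vcarrier E; ndist E (vzero E) y < r\<rbrakk> \<Longrightarrow> y \<in> U"
    using E.openin_ntopo_ballD[OF U(1,2)] by blast
  have small: "vnorm F (T y) < 1" if "y \<in> vcarrier E" "vnorm E y < r" for y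
    using U(3)[OF r(2)[of y]] that linear_betweenD(1)[OF lin, of y]
    by (simp add: T0 E.norm_eq_ndist F.norm_eq_ndist Metric_space.commute[OF E.Metric_space]
        Metric_space.commute[OF F.Metric_space])
  have "vnorm F (T x) \<le> (2 / r) * vnorm E x" if x: "x \<in> vcarrier E" for x
  proof (cases "vnorm E x = 0")
    case True
    then show ?thesis using x E.norm_zero_imp[OF x] by (simp add: T0)
  next
    case False
    then have pos: "vnorm E x > 0" using E.norm_nonneg[OF x] by simp
    \<comment> \<open>Rescales \<open>x\<close> to norm \<open>r / 2\<close>, inside the ball on
      which \<open>T\<close> stays below 1. This is the origin of the constant
      \<open>2 / r\<close>.\<close>
    define c where "c = r / (2 * vnorm E x)"
    have c: "c > 0" using pos r(1) by (simp add: c_def)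
    have "vnorm E (vscale E c x) < r"
      using x pos r(1) by (simp add: E.norm_scale c_def)
    then have "vnorm F (T (vscale E c x)) < 1" using small x by simp
    then have "c * vnorm F (T x) < 1"
      using x c linear_betweenD[OF lin] by (simp add: F.norm_scale)
    then show ?thesis using pos r(1) by (simp add: c_def field_simps)
  qed
  then have "bounded_linear_map E F T (2 / r)"
    using r(1) by unfold_locales (auto simp: lin)
  then show thesis using that by blast
qed

section \<open>The operator norm and the normed space of continuous linear maps\<close>

context normed_carrier_pair
begin

lemma cont_linear_maps_bounded:
  assumes "T \<in> cont_linear_maps E F"
  obtains C where "bounded_linear_map E F T C"
  using assms continuous_linear_imp_bounded[of T] by (auto simp: cont_linear_maps_def)

lemma cont_linear_mapsI:
  assumes "bounded_linear_map E F T C" "T \<in> extensional (vcarrier E)"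
  shows "T \<in> cont_linear_maps E F"
  using assms bounded_linear_map.continuous[OF assms(1)] bounded_linear_map.linear[OF assms(1)]
  by (simp add: cont_linear_maps_def)

lemma operator_space_simps [simp]:
  "vcarrier (operator_space E F) = cont_linear_maps E F"
  "vzero (operator_space E F) = (\<lambda>x\<in>vcarrier E. vzero F)"
  "vadd (operator_space E F) S T = (\<lambda>x\<in>vcarrier E. vadd F (S x) (T x))"
  "vscale (operator_space E F) c T = (\<lambda>x\<in>vcarrier E. vscale F c (T x))"
  by (simp_all add: operator_space_def)

text \<open>A real \<open>SUP\<close> dominates its members only if the set is bounded above; this
  supplies that side condition for every continuous linear map.\<close>

lemma bdd_above_operator_norm:
  assumes "bounded_linear_map E F T C"
  shows "bdd_above ((\<lambda>x. vnorm F (T x)) ` {x \<in> vcarrier E. vnorm E x \<le> 1})"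
proof (rule bdd_aboveI2)
  interpret bounded_linear_map E F T C by fact
  fix x assume x: "x \<in> {x \<in> vcarrier E. vnorm E x \<le> 1}"
  have "vnorm F (T x) \<le> C * vnorm E x" using x bound by simp
  also have "\<dots> \<le> C" using x C_nonneg by (simp add: mult_left_le)
  finally show "vnorm F (T x) \<le> C" .
qed

lemma norm_apply_le_1:
  assumes "T \<in> cont_linear_maps E F" "x \<in> vcarrier E" "vnorm E x \<le> 1"
  shows "vnorm F (T x) \<le> vnorm (operator_space E F) T"
proof -
  obtain C where "bounded_linear_map E F T C" using cont_linear_maps_bounded[OF assms(1)] .
  then show ?thesis
    using assms(2,3) bdd_above_operator_norm by (auto simp: operator_space_def intro!: cSUP_upper)
qed

lemma operator_norm_le:
  assumes "\<And>x. \<lbrakk>x \<in> vcarrier E; vnorm E x \<le> 1\<rbrakk> \<Longrightarrow> vnorm F (T x) \<le> c"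
  shows "vnorm (operator_space E F) T \<le> c"
proof -
  \<comment> \<open>The zero vector makes the unit ball nonempty, without which a real
    \<open>SUP\<close> has no useful upper estimate.\<close>
  have "vzero E \<in> {x \<in> vcarrier E. vnorm E x \<le> 1}" by simp
  then have "{x \<in> vcarrier E. vnorm E x \<le> 1} \<noteq> {}" by blast
  then show ?thesis
    unfolding operator_space_def nspace.simps by (rule cSUP_least) (simp add: assms)
qed

lemma norm_apply_le:
  assumes T: "T \<in> cont_linear_maps E F" and x: "x \<in> vcarrier E"
  shows "vnorm F (T x) \<le> vnorm (operator_space E F) T * vnorm E x"
proof -
  obtain C where "bounded_linear_map E F T C" using cont_linear_maps_bounded[OF T] .
  then interpret bounded_linear_map E F T C .
  show ?thesis
  proof (cases "vnorm E x = 0")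
    case True
    then show ?thesis using bound[OF x] by simp
  next
    case False
    then have pos: "vnorm E x > 0" using E.norm_nonneg[OF x] by simp
    define y where "y = vscale E (1 / vnorm E x) x"
    have "vnorm F (T y) \<le> vnorm (operator_space E F) T"
      using pos x by (intro norm_apply_le_1 T) (auto simp: y_def E.norm_scale)
    then show ?thesis
      using pos x by (simp add: y_def scale F.norm_scale field_simps)
  qed
qed

text \<open>Operators are extensional functions, so equations between them, and separation in
  particular, can be checked on the carrier of \<open>E\<close>. Closure under the operations is
  proved through explicit bounds: \<open>B + C\<close> for sums and \<open>\<bar>c\<bar> * C\<close>
  for multiples.\<close>

lemma normed_carrier_operator_space: "normed_carrier (operator_space E F)"
proof -
  let ?L = "operator_space E F"
  have mem: "T x \<in> vcarrier F" if "T \<in> cont_linear_maps E F" "x \<in> vcarrier E" for T x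
    using that by (auto simp: cont_linear_maps_def linear_between_def)
  have ext: "S = T"
    if "S \<in> extensional (vcarrier E)" "T \<in> extensional (vcarrier E)"
      "\<And>x. x \<in> vcarrier E \<Longrightarrow> S x = T x" for S T :: "'a \<Rightarrow> 'b"
    using that by (rule extensionalityI)
  have cext: "T \<in> extensional (vcarrier E)" if "T \<in> cont_linear_maps E F" for T
    using that by (simp add: cont_linear_maps_def)
  have restrict_eq: "(\<lambda>x\<in>vcarrier E. T x) = T" if "T \<in> cont_linear_maps E F" for T
    using cext[OF that] by (rule extensional_restrict)
  have zero: "(\<lambda>x\<in>vcarrier E. vzero F) \<in> cont_linear_maps E F"
    by (rule cont_linear_mapsI[of _ 0], unfold_locales) (auto simp: linear_between_def)
  have add: "(\<lambda>x\<in>vcarrier E. vadd F (S x) (T x)) \<in> cont_linear_maps E F"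
    if S: "S \<in> cont_linear_maps E F" and T: "T \<in> cont_linear_maps E F" for S T
  proof -
    obtain B C where "bounded_linear_map E F S B" "bounded_linear_map E F T C"
      using cont_linear_maps_bounded S T by metis
    then interpret S: bounded_linear_map E F S B + T: bounded_linear_map E F T C .
    have "vnorm F (vadd F (S x) (T x)) \<le> (B + C) * vnorm E x" if "x \<in> vcarrier E" for x
      using F.norm_triangle[of "S x" "T x"] S.bound[OF that] T.bound[OF that] that
      by (simp add: distrib_right)
    then have "bounded_linear_map E F (\<lambda>x\<in>vcarrier E. vadd F (S x) (T x)) (B + C)"
      using S.C_nonneg T.C_nonneg
      by unfold_locales (auto simp: linear_between_def S.add T.add S.scale T.scale F.scale_add
          F.add_assoc F.add_left_commute)
    then show ?thesis by (rule cont_linear_mapsI) simp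
  qed
  have scale: "(\<lambda>x\<in>vcarrier E. vscale F c (T x)) \<in> cont_linear_maps E F"
    if T: "T \<in> cont_linear_maps E F" for c T
  proof -
    obtain C where "bounded_linear_map E F T C"
      using cont_linear_maps_bounded T by metis
    then interpret T: bounded_linear_map E F T C .
    have "vnorm F (vscale F c (T x)) \<le> (\<bar>c\<bar> * C) * vnorm E x" if "x \<in> vcarrier E" for x
      using T.bound[OF that] that by (simp add: F.norm_scale mult.assoc mult_left_mono)
    then have "bounded_linear_map E F (\<lambda>x\<in>vcarrier E. vscale F c (T x)) (\<bar>c\<bar> * C)"
      using T.C_nonneg
      by unfold_locales (auto simp: linear_between_def T.add T.scale F.scale_add mult.commute)
    then show ?thesis by (rule cont_linear_mapsI) simp
  qed
  have norm_scale_le: "vnorm ?L (vscale ?L c T) \<le> \<bar>c\<bar> * vnorm ?L T"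
    if T: "T \<in> cont_linear_maps E F" for c T
    by (rule operator_norm_le) (simp add: F.norm_scale mem T norm_apply_le_1 mult_left_mono)
  have norm_nonneg: "0 \<le> vnorm ?L T" if T: "T \<in> cont_linear_maps E F" for T
    using norm_apply_le_1[OF T, of "vzero E"] F.norm_nonneg[OF mem[OF T, of "vzero E"]] by simp
  show ?thesis
  proof unfold_locales
    show "vnorm ?L (vadd ?L S T) \<le> vnorm ?L S + vnorm ?L T"
      if "S \<in> vcarrier ?L" "T \<in> vcarrier ?L" for S T
    proof (rule operator_norm_le)
      fix x assume x: "x \<in> vcarrier E" "vnorm E x \<le> 1"
      show "vnorm F (vadd ?L S T x) \<le> vnorm ?L S + vnorm ?L T"
        using F.norm_triangle[of "S x" "T x"] norm_apply_le_1[of S x] norm_apply_le_1[of T x] that x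
        by (simp add: mem)
    qed
    show "vnorm ?L (vscale ?L c T) = \<bar>c\<bar> * vnorm ?L T" if "T \<in> vcarrier ?L" for c T
    proof (cases "c = 0")
      case True
      then show ?thesis
        using norm_scale_le[of T c] norm_nonneg[OF scale[of T c]] that by simp
    next
      case False
      \<comment> \<open>The missing inequality of homogeneity is \<open>norm_scale_le\<close>
        applied to the multiple by \<open>1 / c\<close>.\<close>
      have "vscale ?L (1 / c) (vscale ?L c T) = T"
        using that False by (intro ext) (auto simp: mem cext)
      then have "vnorm ?L T \<le> \<bar>1 / c\<bar> * vnorm ?L (vscale ?L c T)"
        using norm_scale_le[of "vscale ?L c T" "1 / c"] scale[of T c] that by simp
      then have "\<bar>c\<bar> * vnorm ?L T \<le> vnorm ?L (vscale ?L c T)"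
        using False by (simp add: field_simps abs_mult)
      then show ?thesis using norm_scale_le[of T c] that by simp
    qed
    show "T = vzero ?L" if "T \<in> vcarrier ?L" "vnorm ?L T = 0" for T
    proof (rule ext)
      fix x assume x: "x \<in> vcarrier E"
      then have "vnorm F (T x) = 0"
        using norm_apply_le[of T x] F.norm_nonneg[of "T x"] that by (simp add: mem)
      then show "T x = vzero ?L x" using F.norm_zero_imp x that by (simp add: mem)
    qed (use that in \<open>auto simp: cext\<close>)
    show "vadd ?L S T = vadd ?L T S" if "S \<in> vcarrier ?L" "T \<in> vcarrier ?L" for S T
      using that by (intro ext) (auto simp: mem intro: F.add_commute)
  qed (auto simp: zero add scale mem F.add_assoc F.scale_add F.add_scale restrict_eq cong: restrict_cong)
qed

end

section \<open>Local Banach spaces and bonding maps\<close>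

lemma graded_frechet_seminorm: "graded_frechet \<nu> \<Longrightarrow> seminorm (\<nu> n)"
  by (simp add: graded_frechet_def)

lemma graded_frechet_mono:
  assumes "graded_frechet \<nu>" "i \<le> j"
  shows "\<nu> i x \<le> \<nu> j x"
proof (rule lift_Suc_mono_le[of "\<lambda>n. \<nu> n x", OF _ assms(2)])
  show "\<nu> n x \<le> \<nu> (Suc n) x" for n
    using assms(1) unfolding graded_frechet_def by blast
qed

lemma normed_carrier_local_banach:
  "seminorm (\<nu> n) \<Longrightarrow> normed_carrier (local_banach \<nu> n)"
  unfolding local_banach_def
  by (intro normed_carrier.normed_carrier_ncompletion normed_carrier_quotient_space)

lemma quotient_map_bounded_linear:
  assumes p: "seminorm p" and q: "seminorm q" and le: "\<And>x. p x \<le> q x"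
  shows "bounded_linear_map (quotient_space q) (quotient_space p) (\<lambda>A. \<Union>a\<in>A. ker_coset p a) 1"
proof -
  interpret P: normed_carrier "quotient_space p" by (rule normed_carrier_quotient_space[OF p])
  interpret Q: normed_carrier "quotient_space q" by (rule normed_carrier_quotient_space[OF q])
  show ?thesis
    by unfold_locales
      (auto simp: linear_between_def quotient_space_carrier quotient_space_add quotient_space_scale
        quotient_space_norm p q Union_ker_coset[OF p le q] le)
qed

lemma bond_bounded_linear:
  assumes "graded_frechet \<nu>" "i \<le> j"
  shows "bounded_linear_map (local_banach \<nu> j) (local_banach \<nu> i) (bond \<nu> i j) 1"
  unfolding local_banach_def bond_def
  by (intro bounded_linear_map.completion_map_bounded_linear quotient_map_bounded_linear
      graded_frechet_seminorm graded_frechet_mono assms)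

text \<open>Every element of a local space is represented by a sequence of vectors of the original
  space. On such representatives a bonding map changes only the seminorm and keeps the vectors,
  which makes the functoriality of \<open>bond\<close> a direct computation.\<close>

lemma local_banach_cases:
  assumes "graded_frechet \<nu>" "X \<in> vcarrier (local_banach \<nu> n)"
  obtains a where "(\<lambda>k. ker_coset (\<nu> n) (a k)) \<in> ncauchy (quotient_space (\<nu> n))"
    and "X = null_rel (quotient_space (\<nu> n)) `` {\<lambda>k. ker_coset (\<nu> n) (a k)}"
proof -
  interpret normed_carrier "quotient_space (\<nu> n)"
    by (intro normed_carrier_quotient_space graded_frechet_seminorm assms)
  obtain x where x: "x \<in> ncauchy (quotient_space (\<nu> n))" "X = ccls x"
    using assms(2) unfolding local_banach_def ncompletion_carrier by blast
  have "\<forall>k. \<exists>b. x k = ker_coset (\<nu> n) b"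
    using ncauchy_closed[OF x(1)] by (auto simp: quotient_space_carrier)
  then obtain a where "\<And>k. x k = ker_coset (\<nu> n) (a k)" by metis
  then have "x = (\<lambda>k. ker_coset (\<nu> n) (a k))" by auto
  then show thesis using that x by blast
qed

lemma bond_class:
  assumes "graded_frechet \<nu>" "i \<le> j"
    and "(\<lambda>k. ker_coset (\<nu> j) (a k)) \<in> ncauchy (quotient_space (\<nu> j))"
  shows "bond \<nu> i j (null_rel (quotient_space (\<nu> j)) `` {\<lambda>k. ker_coset (\<nu> j) (a k)})
      = null_rel (quotient_space (\<nu> i)) `` {\<lambda>k. ker_coset (\<nu> i) (a k)}"
    and "(\<lambda>k. ker_coset (\<nu> i) (a k)) \<in> ncauchy (quotient_space (\<nu> i))"
proof -
  have s: "seminorm (\<nu> i)" "seminorm (\<nu> j)" using assms(1) by (simp_all add: graded_frechet_seminorm)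
  note le = graded_frechet_mono[OF assms(1,2)]
  interpret bounded_linear_map "quotient_space (\<nu> j)" "quotient_space (\<nu> i)"
    "\<lambda>A. \<Union>a\<in>A. ker_coset (\<nu> i) a" 1
    by (rule quotient_map_bounded_linear[OF s le])
  note U = Union_ker_coset[OF s(1) le s(2)]
  show "bond \<nu> i j (null_rel (quotient_space (\<nu> j)) `` {\<lambda>k. ker_coset (\<nu> j) (a k)})
      = null_rel (quotient_space (\<nu> i)) `` {\<lambda>k. ker_coset (\<nu> i) (a k)}"
    unfolding bond_def completion_map_ccls[OF assms(3)] by (simp only: U)
  show "(\<lambda>k. ker_coset (\<nu> i) (a k)) \<in> ncauchy (quotient_space (\<nu> i))"
    using ncauchy_image[OF assms(3)] by (simp only: U)
qed

lemma bond_self: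
  assumes "graded_frechet \<nu>" "X \<in> vcarrier (local_banach \<nu> n)"
  shows "bond \<nu> n n X = X"
  using local_banach_cases[OF assms] bond_class(1)[OF assms(1) order_refl] by metis

lemma bond_bond:
  assumes "graded_frechet \<nu>" "i \<le> j" "j \<le> k" "X \<in> vcarrier (local_banach \<nu> k)"
  shows "bond \<nu> i j (bond \<nu> j k X) = bond \<nu> i k X"
proof -
  obtain a where a: "(\<lambda>n. ker_coset (\<nu> k) (a n)) \<in> ncauchy (quotient_space (\<nu> k))"
    and X: "X = null_rel (quotient_space (\<nu> k)) `` {\<lambda>n. ker_coset (\<nu> k) (a n)}"
    using local_banach_cases[OF assms(1,4)] .
  note jk = bond_class[OF assms(1,3) a]
  show ?thesis
    unfolding X jk(1) bond_class(1)[OF assms(1,2) jk(2)]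
    using bond_class(1)[OF assms(1) order_trans[OF assms(2,3)] a] by simp
qed

section \<open>Spaces in which lines are continuous\<close>

text \<open>The property of a source space that drives the differentiation argument. It passes to
  \<open>point_space\<close> and to \<open>square_space\<close>, so it survives the induction on the
  order of differentiability.\<close>

definition continuous_lines :: "'a tspace \<Rightarrow> bool" where
  "continuous_lines E \<longleftrightarrow> topspace (vtopo E) = vcarrier E \<and>
     (\<forall>c. \<forall>v\<in>vcarrier E. vscale E c v \<in> vcarrier E) \<and>
     (\<forall>x\<in>vcarrier E. \<forall>v\<in>vcarrier E. vadd E x (vscale E 0 v) = x \<and>
        continuous_map euclideanreal (vtopo E) (\<lambda>t. vadd E x (vscale E t v)))"

lemma frechet_limit_simps [simp]:
  "vcarrier (frechet_limit \<nu>) = frechet_threads \<nu>"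
  "vadd (frechet_limit \<nu>) q q' = (\<lambda>n. vadd (local_banach \<nu> n) (q n) (q' n))"
  "vscale (frechet_limit \<nu>) c q = (\<lambda>n. vscale (local_banach \<nu> n) c (q n))"
  by (simp_all add: frechet_limit_def)

lemma frechet_threads_closed: "q \<in> frechet_threads \<nu> \<Longrightarrow> q n \<in> vcarrier (local_banach \<nu> n)"
  by (simp add: frechet_threads_def)

text \<open>Threads are stable under the linear operations because bonding maps are linear.
  Continuity of a line into the limit is tested on coordinates, where it is
  \<open>continuous_map_line\<close>.\<close>

lemma
  assumes \<nu>: "graded_frechet \<nu>"
  shows topspace_frechet_limit: "topspace (vtopo (frechet_limit \<nu>)) = frechet_threads \<nu>"
    and continuous_map_frechet_limit_proj:
      "continuous_map (vtopo (frechet_limit \<nu>)) (ntopo (local_banach \<nu> n)) (\<lambda>q. q n)"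
    and continuous_lines_frechet_limit: "continuous_lines (frechet_limit \<nu>)"
proof -
  interpret L: normed_carrier "local_banach \<nu> n" for n
    by (intro normed_carrier_local_banach graded_frechet_seminorm \<nu>)
  have top: "q n \<in> topspace (ntopo (local_banach \<nu> n))" if "q \<in> frechet_threads \<nu>" for q n
    using that by (simp add: frechet_threads_closed)
  show 1: "topspace (vtopo (frechet_limit \<nu>)) = frechet_threads \<nu>"
    by (simp add: frechet_limit_def, rule topspace_initial_topology) (simp_all add: frechet_threads_closed)
  show "continuous_map (vtopo (frechet_limit \<nu>)) (ntopo (local_banach \<nu> n)) (\<lambda>q. q n)"
    by (simp add: frechet_limit_def, rule continuous_map_initial_topology_proj[where p = "\<lambda>n q. q n"])
      (simp_all add: frechet_threads_closed)
  have scale: "(\<lambda>n. vscale (local_banach \<nu> n) c (v n)) \<in> frechet_threads \<nu>"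
    if v: "v \<in> frechet_threads \<nu>" for c v
  proof -
    have "bond \<nu> i j (vscale (local_banach \<nu> j) c (v j)) = vscale (local_banach \<nu> i) c (v i)"
      if "i \<le> j" for i j
      using bounded_linear_map.scale[OF bond_bounded_linear[OF \<nu> that], of "v j" c] v that
      by (simp add: frechet_threads_def)
    then show ?thesis using v unfolding frechet_threads_def by simp
  qed
  have line: "(\<lambda>n. vadd (local_banach \<nu> n) (q n) (vscale (local_banach \<nu> n) t (v n)))
      \<in> frechet_threads \<nu>"
    if "q \<in> frechet_threads \<nu>" "v \<in> frechet_threads \<nu>" for q v t
  proof -
    have "bond \<nu> i j (vadd (local_banach \<nu> j) (q j) (vscale (local_banach \<nu> j) t (v j)))
        = vadd (local_banach \<nu> i) (q i) (vscale (local_banach \<nu> i) t (v i))" if "i \<le> j" for i j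
      using bounded_linear_map.add[OF bond_bounded_linear[OF \<nu> that], of "q j"
          "vscale (local_banach \<nu> j) t (v j)"] \<open>q \<in> _\<close> scale[OF \<open>v \<in> _\<close>, of t] that
      by (simp add: frechet_threads_def)
    then show ?thesis
      using that unfolding frechet_threads_def by simp
  qed
  have "continuous_map euclideanreal (vtopo (frechet_limit \<nu>))
      (\<lambda>t n. vadd (local_banach \<nu> n) (q n) (vscale (local_banach \<nu> n) t (v n)))"
    if "q \<in> frechet_threads \<nu>" "v \<in> frechet_threads \<nu>" for q v
    unfolding continuous_map_eq_topcontinuous_at
  proof
    fix t :: real
    have "topcontinuous_at euclideanreal (ntopo (local_banach \<nu> n))
       (\<lambda>t. vadd (local_banach \<nu> n) (q n) (vscale (local_banach \<nu> n) t (v n))) t" for n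
      using L.continuous_map_line[of "q n" n "v n"] that
      by (simp add: continuous_map_eq_topcontinuous_at frechet_threads_closed)
    then show "topcontinuous_at euclideanreal (vtopo (frechet_limit \<nu>))
      (\<lambda>t n. vadd (local_banach \<nu> n) (q n) (vscale (local_banach \<nu> n) t (v n))) t"
      using that line top
      by (simp add: frechet_limit_def, intro topcontinuous_at_initial_topology) auto
  qed
  then show "continuous_lines (frechet_limit \<nu>)"
    by (simp add: continuous_lines_def 1 frechet_threads_closed scale)
qed

section \<open>Iterated products of the source space\<close>

lemma linear_between_point_space:
  assumes "linear_between E F f"
  shows "linear_between (point_space E) (point_space F) (\<lambda>p. Point (f (the_point p)))"
  using assms by (auto simp: linear_between_def point_space_def)

lemma topspace_point_space:
  "topspace (vtopo E) = vcarrier E \<Longrightarrow> topspace (vtopo (point_space E)) = Point ` vcarrier E"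
  by (auto simp: point_space_def topspace_pullback_topology)

lemma continuous_map_point_space:
  assumes "continuous_map X (vtopo E) f" "topspace (vtopo E) \<subseteq> vcarrier E"
  shows "continuous_map X (vtopo (point_space E)) (\<lambda>x. Point (f x))"
proof -
  have "f x \<in> vcarrier E" if "x \<in> topspace X" for x
    using continuous_map_image_subset_topspace[OF assms(1)] assms(2) that by blast
  then show ?thesis
    using assms(1) by (simp add: point_space_def, intro continuous_map_pullback') (auto simp: o_def)
qed

lemma continuous_map_the_point: "continuous_map (vtopo (point_space E)) (vtopo E) the_point"
  using continuous_map_pullback[OF continuous_map_id[of "vtopo E"], of "Point ` vcarrier E" the_point]
  by (simp add: point_space_def)

lemma openin_point_space:
  assumes "openin (vtopo E) U" "U \<subseteq> vcarrier E"
  shows "openin (vtopo (point_space E)) (Point ` U)"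
proof -
  have "Point ` U = the_point -` U \<inter> Point ` vcarrier E" using assms(2) by force
  then show ?thesis
    using assms(1) by (auto simp: point_space_def openin_pullback_topology)
qed

lemma continuous_lines_point_space:
  assumes "continuous_lines E"
  shows "continuous_lines (point_space E)"
  unfolding continuous_lines_def
proof (intro conjI ballI allI)
  show "topspace (vtopo (point_space E)) = vcarrier (point_space E)"
    using assms by (simp add: topspace_point_space continuous_lines_def) (simp add: point_space_def)
  show "vscale (point_space E) c v \<in> vcarrier (point_space E)" if "v \<in> vcarrier (point_space E)" for c v
    using that assms by (auto simp: continuous_lines_def point_space_def)
  fix x v assume "x \<in> vcarrier (point_space E)" "v \<in> vcarrier (point_space E)"
  then obtain x' v' where x: "x = Point x'" "x' \<in> vcarrier E" and v: "v = Point v'" "v' \<in> vcarrier E"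
    by (auto simp: point_space_def)
  show "vadd (point_space E) x (vscale (point_space E) 0 v) = x"
    using assms x v by (simp add: continuous_lines_def point_space_def)
  have "continuous_map euclideanreal (vtopo (point_space E))
     (\<lambda>t. Point (vadd E x' (vscale E t v')))"
    using assms x v by (intro continuous_map_point_space) (auto simp: continuous_lines_def)
  then show "continuous_map euclideanreal (vtopo (point_space E))
     (\<lambda>t. vadd (point_space E) x (vscale (point_space E) t v))"
    using x v by (simp add: point_space_def)
qed

lemma square_space_simps [simp]:
  "vcarrier (square_space E) = pairing_set (vcarrier E) (vcarrier E)"
  "vadd (square_space E) p q = Pairing (vadd E (pfst p) (pfst q)) (vadd E (psnd p) (psnd q))"
  "vscale (square_space E) c p = Pairing (vscale E c (pfst p)) (vscale E c (psnd p))"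
  by (simp_all add: square_space_def)

lemma mem_pairing_set [simp]: "Pairing p q \<in> pairing_set A B \<longleftrightarrow> p \<in> A \<and> q \<in> B"
  by (simp add: pairing_set_def)

lemma ball_pairing_set [simp]:
  "(\<forall>x\<in>pairing_set A B. P x) \<longleftrightarrow> (\<forall>p\<in>A. \<forall>q\<in>B. P (Pairing p q))"
  by (auto simp: pairing_set_def)

lemma linear_between_square_space:
  assumes "linear_between E F f"
  shows "linear_between (square_space E) (square_space F) (\<lambda>p. Pairing (f (pfst p)) (f (psnd p)))"
  using assms by (simp add: linear_between_def Pi_iff)

lemma topspace_square_space:
  "topspace (vtopo E) = vcarrier E
    \<Longrightarrow> topspace (vtopo (square_space E)) = pairing_set (vcarrier E) (vcarrier E)"
  by (auto simp: square_space_def topspace_pullback_topology pairing_set_def)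

lemma continuous_map_square_space:
  assumes "continuous_map X (vtopo E) f" "continuous_map X (vtopo E) g"
    "topspace (vtopo E) \<subseteq> vcarrier E"
  shows "continuous_map X (vtopo (square_space E)) (\<lambda>x. Pairing (f x) (g x))"
proof -
  have "f x \<in> vcarrier E" "g x \<in> vcarrier E" if "x \<in> topspace X" for x
    using continuous_map_image_subset_topspace[OF assms(1)]
      continuous_map_image_subset_topspace[OF assms(2)] assms(3) that by blast+
  then show ?thesis
    using assms(1,2) by (simp add: square_space_def, intro continuous_map_pullback')
      (auto simp: o_def continuous_map_pairwise)
qed

lemma continuous_map_square_space_proj:
  "continuous_map (vtopo (square_space E)) (vtopo E) pfst"
  "continuous_map (vtopo (square_space E)) (vtopo E) psnd"
proof -
  let ?A = "pairing_set (vcarrier E) (vcarrier E)"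
  let ?f = "\<lambda>p :: 'a pairing. (pfst p, psnd p)"
  show "continuous_map (vtopo (square_space E)) (vtopo E) pfst"
    using continuous_map_pullback[OF continuous_map_fst[of "vtopo E" "vtopo E"], of ?A ?f]
    by (simp add: square_space_def o_def)
  show "continuous_map (vtopo (square_space E)) (vtopo E) psnd"
    using continuous_map_pullback[OF continuous_map_snd[of "vtopo E" "vtopo E"], of ?A ?f]
    by (simp add: square_space_def o_def)
qed

lemma openin_square_space:
  assumes U: "openin (vtopo E) U" and top: "topspace (vtopo E) = vcarrier E"
  shows "openin (vtopo (square_space E)) (pairing_set U (vcarrier E))"
proof -
  have "U \<subseteq> vcarrier E" using openin_subset[OF U] top by simp
  then have "pairing_set U (vcarrier E)
      = (\<lambda>p. (pfst p, psnd p)) -` (U \<times> vcarrier E) \<inter> pairing_set (vcarrier E) (vcarrier E)"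
    by (auto simp: pairing_set_def)
  moreover have "openin (prod_topology (vtopo E) (vtopo E)) (U \<times> vcarrier E)"
    using U top openin_topspace[of "vtopo E"] by (simp add: openin_prod_Times_iff)
  ultimately show ?thesis
    unfolding square_space_def openin_pullback_topology tspace.simps by blast
qed

lemma continuous_lines_square_space:
  assumes E: "continuous_lines E"
  shows "continuous_lines (square_space E)"
proof -
  have "continuous_map euclideanreal (vtopo (square_space E))
     (\<lambda>t. Pairing (vadd E x (vscale E t v)) (vadd E y (vscale E t w)))"
    if "x \<in> vcarrier E" "y \<in> vcarrier E" "v \<in> vcarrier E" "w \<in> vcarrier E" for x y v w
    using E that by (intro continuous_map_square_space) (auto simp: continuous_lines_def)
  then show ?thesis
    using E by (simp add: continuous_lines_def topspace_square_space)
qed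

section \<open>Spaces of compatible operators\<close>

locale shift_operators =
  fixes \<nu>2 :: "nat \<Rightarrow> 'b::real_vector \<Rightarrow> real" and \<nu>3 :: "nat \<Rightarrow> 'c::real_vector \<Rightarrow> real"
    and r s :: nat
  assumes \<nu>2: "graded_frechet \<nu>2" and \<nu>3: "graded_frechet \<nu>3"
begin

sublocale P: normed_carrier_pair "local_banach \<nu>2 (n + r)" "local_banach \<nu>3 (n - s)" for n
  by (intro normed_carrier_pair.intro normed_carrier_local_banach graded_frechet_seminorm \<nu>2 \<nu>3)

abbreviation ops where "ops \<equiv> shift_ops \<nu>2 \<nu>3 r s"
abbreviation compat where "compat \<equiv> compatible_ops \<nu>2 \<nu>3 r s"

sublocale O: normed_carrier "ops n" for n
  unfolding shift_ops_def by (rule P.normed_carrier_operator_space)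

lemma apply_closed:
  "\<lbrakk>T \<in> vcarrier (ops n); y \<in> vcarrier (local_banach \<nu>2 (n + r))\<rbrakk>
    \<Longrightarrow> T y \<in> vcarrier (local_banach \<nu>3 (n - s))"
  by (auto simp: shift_ops_def cont_linear_maps_def linear_between_def)

lemma ops_apply:
  assumes "y \<in> vcarrier (local_banach \<nu>2 (n + r))"
  shows "vzero (ops n) y = vzero (local_banach \<nu>3 (n - s))"
    and "vadd (ops n) S T y = vadd (local_banach \<nu>3 (n - s)) (S y) (T y)"
    and "vscale (ops n) c T y = vscale (local_banach \<nu>3 (n - s)) c (T y)"
    and "vminus (ops n) S T y = vminus (local_banach \<nu>3 (n - s)) (S y) (T y)"
  using assms by (simp_all add: shift_ops_def vminus_def)

lemma compatD:
  assumes "L \<in> compat I" "i \<in> I"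
  shows "L i \<in> vcarrier (ops i)"
    and "\<lbrakk>j \<in> I; i \<le> j; x \<in> vcarrier (local_banach \<nu>2 (j + r))\<rbrakk>
      \<Longrightarrow> bond \<nu>3 (i - s) (j - s) (L j x) = L i (bond \<nu>2 (i + r) (j + r) x)"
  using assms by (auto simp: compatible_ops_def)

lemma compat_extensional: "L \<in> compat I \<Longrightarrow> L \<in> extensional I"
  by (simp add: compatible_ops_def PiE_def)

lemma compatI:
  assumes "\<And>i. i \<in> I \<Longrightarrow> L i \<in> vcarrier (ops i)" "L \<in> extensional I"
    and "\<And>i j x. \<lbrakk>i \<in> I; j \<in> I; i \<le> j; x \<in> vcarrier (local_banach \<nu>2 (j + r))\<rbrakk>
      \<Longrightarrow> bond \<nu>3 (i - s) (j - s) (L j x) = L i (bond \<nu>2 (i + r) (j + r) x)"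
  shows "L \<in> compat I"
  using assms by (simp add: compatible_ops_def PiE_def)

lemma bond_source_closed:
  "\<lbrakk>i \<le> j; x \<in> vcarrier (local_banach \<nu>2 (j + r))\<rbrakk>
    \<Longrightarrow> bond \<nu>2 (i + r) (j + r) x \<in> vcarrier (local_banach \<nu>2 (i + r))"
  by (rule bounded_linear_map.closed[OF bond_bounded_linear[OF \<nu>2]]) auto

lemma bond_target_linear: "i \<le> j \<Longrightarrow>
    bounded_linear_map (local_banach \<nu>3 (j - s)) (local_banach \<nu>3 (i - s)) (bond \<nu>3 (i - s) (j - s)) 1"
  by (rule bond_bounded_linear[OF \<nu>3]) simp

text \<open>This and the next two lemmas rest on the linearity of the bonding maps. They are used to
  see that the remainder of the limit map takes its values in the limit space.\<close>

lemma compat_zero: "(\<lambda>i\<in>I. vzero (ops i)) \<in> compat I"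
proof (rule compatI)
  fix i j x assume ij: "i \<in> I" "j \<in> I" "i \<le> j" and x: "x \<in> vcarrier (local_banach \<nu>2 (j + r))"
  interpret B: bounded_linear_map "local_banach \<nu>3 (j - s)" "local_banach \<nu>3 (i - s)"
    "bond \<nu>3 (i - s) (j - s)" 1 by (rule bond_target_linear[OF ij(3)])
  have "bond \<nu>3 (i - s) (j - s) (vzero (local_banach \<nu>3 (j - s))) = vzero (local_banach \<nu>3 (i - s))"
    using B.scale[of "vzero (local_banach \<nu>3 (j - s))" 0] by simp
  then show "bond \<nu>3 (i - s) (j - s) ((\<lambda>i\<in>I. vzero (ops i)) j x)
      = (\<lambda>i\<in>I. vzero (ops i)) i (bond \<nu>2 (i + r) (j + r) x)"
    using ij x by (simp add: ops_apply bond_source_closed)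
qed auto

lemma compat_add:
  assumes L: "L \<in> compat I" and M: "M \<in> compat I"
  shows "(\<lambda>i\<in>I. vadd (ops i) (L i) (M i)) \<in> compat I"
proof (rule compatI)
  fix i j x assume ij: "i \<in> I" "j \<in> I" "i \<le> j" and x: "x \<in> vcarrier (local_banach \<nu>2 (j + r))"
  interpret B: bounded_linear_map "local_banach \<nu>3 (j - s)" "local_banach \<nu>3 (i - s)"
    "bond \<nu>3 (i - s) (j - s)" 1 by (rule bond_target_linear[OF ij(3)])
  show "bond \<nu>3 (i - s) (j - s) ((\<lambda>i\<in>I. vadd (ops i) (L i) (M i)) j x)
      = (\<lambda>i\<in>I. vadd (ops i) (L i) (M i)) i (bond \<nu>2 (i + r) (j + r) x)"
    using ij x apply_closed[OF compatD(1)[OF L ij(2)] x] apply_closed[OF compatD(1)[OF M ij(2)] x]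
    by (simp add: ops_apply bond_source_closed B.add
        compatD(2)[OF L ij(1,2,3) x] compatD(2)[OF M ij(1,2,3) x])
qed (simp_all add: compatD(1)[OF L] compatD(1)[OF M])

lemma compat_scale:
  assumes L: "L \<in> compat I"
  shows "(\<lambda>i\<in>I. vscale (ops i) c (L i)) \<in> compat I"
proof (rule compatI)
  fix i j x assume ij: "i \<in> I" "j \<in> I" "i \<le> j" and x: "x \<in> vcarrier (local_banach \<nu>2 (j + r))"
  interpret B: bounded_linear_map "local_banach \<nu>3 (j - s)" "local_banach \<nu>3 (i - s)"
    "bond \<nu>3 (i - s) (j - s)" 1 by (rule bond_target_linear[OF ij(3)])
  show "bond \<nu>3 (i - s) (j - s) ((\<lambda>i\<in>I. vscale (ops i) c (L i)) j x)
      = (\<lambda>i\<in>I. vscale (ops i) c (L i)) i (bond \<nu>2 (i + r) (j + r) x)"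
    using ij x apply_closed[OF compatD(1)[OF L ij(2)] x]
    by (simp add: ops_apply bond_source_closed B.scale compatD(2)[OF L ij(1,2,3) x])
qed (simp_all add: compatD(1)[OF L])

lemma compat_restrict: "\<lbrakk>L \<in> compat I; J \<subseteq> I\<rbrakk> \<Longrightarrow> restrict L J \<in> compat J"
  by (rule compatI) (auto simp: compatD subset_iff)

lemma shift_space_simps [simp]:
  "vcarrier (shift_space \<nu>2 \<nu>3 r s) = compat {s..}"
  "vzero (shift_space \<nu>2 \<nu>3 r s) = (\<lambda>i\<in>{s..}. vzero (ops i))"
  "vadd (shift_space \<nu>2 \<nu>3 r s) L M = (\<lambda>i\<in>{s..}. vadd (ops i) (L i) (M i))"
  "vscale (shift_space \<nu>2 \<nu>3 r s) c L = (\<lambda>i\<in>{s..}. vscale (ops i) c (L i))"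
  by (simp_all add: shift_space_def)

section \<open>Metrics of the truncated spaces and the topology of their projective limit\<close>

lemma ndist_trunc:
  assumes L: "L \<in> compat {s..n}" and M: "M \<in> compat {s..n}"
  shows "ndist (trunc_shift_space \<nu>2 \<nu>3 r s n) L M = (\<Sum>i = s..n. ndist (ops i) (L i) (M i))"
  using L M compatD(1)[OF L] compatD(1)[OF M]
  by (simp add: ndist_def trunc_shift_space_def vminus_def)

text \<open>On the carrier this is a finite sum of metrics. The sum sees only the components with
  index in \<open>{s..n}\<close>, so definiteness also relies on extensionality.\<close>

lemma Metric_space_trunc:
  "Metric_space (compat {s..n}) (ndist (trunc_shift_space \<nu>2 \<nu>3 r s n))"
proof -
  let ?d = "ndist (trunc_shift_space \<nu>2 \<nu>3 r s n)"
  have carrier: "vcarrier (trunc_shift_space \<nu>2 \<nu>3 r s n) = compat {s..n}"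
    by (simp add: trunc_shift_space_def)
  have outside: "?d L M = 0" if "\<not> (L \<in> compat {s..n} \<and> M \<in> compat {s..n})" for L M
    using that by (auto simp: ndist_def carrier)
  note nonneg = Metric_space.nonneg[OF O.Metric_space]
  show ?thesis
  proof
    fix L M
    show "0 \<le> ?d L M"
      using outside[of L M] by (cases "L \<in> compat {s..n} \<and> M \<in> compat {s..n}")
        (auto simp: ndist_trunc intro!: sum_nonneg nonneg)
    show "?d L M = ?d M L"
      using outside[of L M] outside[of M L]
      by (cases "L \<in> compat {s..n} \<and> M \<in> compat {s..n}")
        (auto simp: ndist_trunc Metric_space.commute[OF O.Metric_space])
  next
    fix L M assume L: "L \<in> compat {s..n}" and M: "M \<in> compat {s..n}"
    have "?d L M = 0 \<longleftrightarrow> (\<forall>i\<in>{s..n}. ndist (ops i) (L i) (M i) = 0)"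
      using sum_nonneg_eq_0_iff[of "{s..n}" "\<lambda>i. ndist (ops i) (L i) (M i)"] nonneg
      by (simp add: ndist_trunc L M)
    also have "\<dots> \<longleftrightarrow> (\<forall>i\<in>{s..n}. L i = M i)"
      using compatD(1)[OF L] compatD(1)[OF M] by (simp add: Metric_space.zero[OF O.Metric_space])
    also have "\<dots> \<longleftrightarrow> L = M"
      using extensionalityI[OF compat_extensional[OF L] compat_extensional[OF M]] by blast
    finally show "?d L M = 0 \<longleftrightarrow> L = M" .
  next
    fix L M N assume L: "L \<in> compat {s..n}" and M: "M \<in> compat {s..n}" and N: "N \<in> compat {s..n}"
    have "(\<Sum>i = s..n. ndist (ops i) (L i) (N i))
        \<le> (\<Sum>i = s..n. ndist (ops i) (L i) (M i) + ndist (ops i) (M i) (N i))"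
      using compatD(1)[OF L] compatD(1)[OF M] compatD(1)[OF N]
      by (intro sum_mono Metric_space.triangle[OF O.Metric_space])
    then show "?d L N \<le> ?d L M + ?d M N"
      by (simp add: ndist_trunc L M N sum.distrib)
  qed
qed

text \<open>Each projection of the limit is a truncation, whose distance involves only finitely many
  components; hence the neighbourhoods found for the components can be intersected.\<close>

lemma topcontinuous_at_shift_space:
  assumes x: "x \<in> topspace X" and f: "f \<in> topspace X \<rightarrow> compat {s..}"
    and cont: "\<And>n. n \<ge> s \<Longrightarrow> topcontinuous_at X (ntopo (ops n)) (\<lambda>y. f y n) x"
  shows "topcontinuous_at X (vtopo (shift_space \<nu>2 \<nu>3 r s)) f x"
  unfolding shift_space_def tspace.simps
proof (rule topcontinuous_at_initial_topology[OF x f])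
  fix n L assume "L \<in> compat {s..}"
  then show "restrict L {s..n} \<in> topspace (ntopo (trunc_shift_space \<nu>2 \<nu>3 r s n))"
    using Metric_space.topspace_mtopology[OF Metric_space_trunc]
    by (auto simp: ntopo_def trunc_shift_space_def intro: compat_restrict)
next
  fix n assume "n \<in> {s..}"
  have carrier: "vcarrier (trunc_shift_space \<nu>2 \<nu>3 r s n) = compat {s..n}"
    by (simp add: trunc_shift_space_def)
  have res: "restrict (f y) {s..n} \<in> compat {s..n}" if "y \<in> topspace X" for y
    using f that by (intro compat_restrict) auto
  have "\<exists>U. openin X U \<and> x \<in> U \<and> (\<forall>y\<in>U. ndist (trunc_shift_space \<nu>2 \<nu>3 r s n)
      (restrict (f x) {s..n}) (restrict (f y) {s..n}) < e)" if "e > 0" for e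
  proof -
    define N where "N = real (card {s..n})"
    \<comment> \<open>The \<open>N\<close> components contribute at most \<open>N * d\<close>, and
      dividing by \<open>N + 1\<close> keeps this strictly below \<open>e\<close>.\<close>
    define d where "d = e / (N + 1)"
    have "N \<ge> 0" by (simp add: N_def)
    then have "d > 0" using that by (simp add: d_def)
    then have "\<forall>i\<in>{s..n}. \<exists>U. openin X U \<and> x \<in> U \<and> (\<forall>y\<in>U. ndist (ops i) (f x i) (f y i) < d)"
      using cont unfolding O.topcontinuous_at_ntopo_iff by simp
    then obtain W where W: "\<And>i. i \<in> {s..n} \<Longrightarrow> openin X (W i)" "\<And>i. i \<in> {s..n} \<Longrightarrow> x \<in> W i"
      "\<And>i y. \<lbrakk>i \<in> {s..n}; y \<in> W i\<rbrakk> \<Longrightarrow> ndist (ops i) (f x i) (f y i) < d"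
      by metis
    define U where "U = topspace X \<inter> (\<Inter>i\<in>{s..n}. W i)"
    have "openin X U"
      unfolding U_def by (intro openin_Int_Inter) (use W(1) in auto)
    moreover have "x \<in> U" using W(2) x by (simp add: U_def)
    moreover have "ndist (trunc_shift_space \<nu>2 \<nu>3 r s n) (restrict (f x) {s..n}) (restrict (f y) {s..n}) < e"
      if y: "y \<in> U" for y
    proof -
      have "ndist (trunc_shift_space \<nu>2 \<nu>3 r s n) (restrict (f x) {s..n}) (restrict (f y) {s..n})
          = (\<Sum>i = s..n. ndist (ops i) (f x i) (f y i))"
        using y x by (simp add: ndist_trunc res U_def)
      also have "\<dots> \<le> (\<Sum>i = s..n. d)"
        using W(3) y by (intro sum_mono less_imp_le) (auto simp: U_def)
      also have "\<dots> = N * d" unfolding N_def by (rule sum_constant)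
      also have "\<dots> < e" using \<open>e > 0\<close> \<open>N \<ge> 0\<close> by (simp add: d_def field_simps)
      finally show ?thesis .
    qed
    ultimately show ?thesis by blast
  qed
  then show "topcontinuous_at X (ntopo (trunc_shift_space \<nu>2 \<nu>3 r s n)) (\<lambda>y. restrict (f y) {s..n}) x"
    unfolding ntopo_def carrier Metric_space.topcontinuous_at_mtopology_iff[OF Metric_space_trunc]
    using x res by simp
qed auto

end

section \<open>Projective limits of differentiable maps\<close>

lemma tspace_of_simps [simp]:
  "vcarrier (tspace_of E) = vcarrier E"
  "vzero (tspace_of E) = vzero E"
  "vadd (tspace_of E) = vadd E"
  "vscale (tspace_of E) = vscale E"
  "vtopo (tspace_of E) = ntopo E"
  by (simp_all add: tspace_of_def)

lemma vminus_tspace_of [simp]: "vminus (tspace_of E) x y = vminus E x y"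
  by (simp add: vminus_def)

lemma Ck_on_imp_continuous_map:
  "Ck_on k E F U f \<Longrightarrow> continuous_map (subtopology (vtopo E) U) (vtopo F) f"
  by (cases k) auto

text \<open>With a common increment \<open>a\<close>, two remainders differ only in their derivative
  terms, where the factor \<open>1 / t\<close> cancels \<open>t\<close>. A fixed discrepancy between
  \<open>p\<close> and \<open>q\<close> therefore cannot shrink with \<open>t\<close>.\<close>

lemma (in normed_carrier) ndist_difference_quotients:
  assumes "a \<in> vcarrier E" "p \<in> vcarrier E" "q \<in> vcarrier E" "t \<noteq> 0"
  shows "ndist E (vscale E (1 / t) (vminus E a (vscale E t p))) (vscale E (1 / t) (vminus E a (vscale E t q)))
    = ndist E p q"
proof -
  have *: "vminus E a (vscale E t w) = vadd E a (vscale E (- t) w)" if "w \<in> vcarrier E" for w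
    using that by (simp add: vminus_def)
  have "vminus E (vminus E a (vscale E t p)) (vminus E a (vscale E t q))
      = vadd E (vminus E a a) (vminus E (vscale E (- t) p) (vscale E (- t) q))"
    unfolding *[OF assms(2)] *[OF assms(3)] by (rule add_minus_add) (simp_all add: assms)
  also have "\<dots> = vminus E (vscale E (- t) p) (vscale E (- t) q)"
    using assms by simp
  also have "\<dots> = vscale E (- t) (vminus E p q)"
    using assms by (simp add: scale_minus)
  finally have "ndist E (vminus E a (vscale E t p)) (vminus E a (vscale E t q)) = \<bar>t\<bar> * ndist E p q"
    using assms by (simp add: ndist_eq norm_scale)
  then show ?thesis using assms by (simp add: ndist_scale)
qed

lemma linear_between_line:
  assumes "linear_between E F f" "continuous_lines E" "x \<in> vcarrier E" "v \<in> vcarrier E"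
  shows "f (vadd E x (vscale E t v)) = vadd F (f x) (vscale F t (f v))"
  using assms by (simp add: continuous_lines_def linear_between_def)

lemma open_line_parameters:
  assumes "continuous_lines E" "openin (vtopo E) U" "x \<in> vcarrier E" "v \<in> vcarrier E"
  shows "open {t. vadd E x (vscale E t v) \<in> U}"
  using assms unfolding continuous_lines_def continuous_map_def by auto

text \<open>Remainders are tested on the subspace of those \<open>(t, w)\<close> for which the
  displaced point lies in the domain. Because \<open>\<pi>\<close> commutes with
  \<open>x + t w\<close> and sends \<open>U\<close> into \<open>V\<close>, it carries one such
  subspace into the other, so a remainder on the local space can be pulled back.\<close>

lemma continuous_map_remainder_domain:
  assumes E: "continuous_lines E" and U: "U \<subseteq> vcarrier E" and x: "x \<in> U"
    and lin: "linear_between E F \<pi>" and cont: "continuous_map (vtopo E) (vtopo F) \<pi>"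
    and im: "\<pi> ` U \<subseteq> V"
  shows "continuous_map
      (subtopology (prod_topology euclideanreal (vtopo E)) {(t, w). vadd E x (vscale E t w) \<in> U})
      (subtopology (prod_topology euclideanreal (vtopo F)) {(t, w). vadd F (\<pi> x) (vscale F t w) \<in> V})
      (\<lambda>(t, w). (t, \<pi> w))"
  unfolding continuous_map_in_subtopology
proof
  have "continuous_map (prod_topology euclideanreal (vtopo E)) (prod_topology euclideanreal (vtopo F))
      (\<lambda>(t, w). (t, \<pi> w))"
    using cont by (simp add: case_prod_unfold continuous_map_pairwise o_def continuous_map_fst
        continuous_map_compose[OF continuous_map_snd, unfolded o_def])
  then show "continuous_map
      (subtopology (prod_topology euclideanreal (vtopo E)) {(t, w). vadd E x (vscale E t w) \<in> U})
      (prod_topology euclideanreal (vtopo F)) (\<lambda>(t, w). (t, \<pi> w))"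
    by (rule continuous_map_from_subtopology)
  show "(\<lambda>(t, w). (t, \<pi> w)) \<in>
      topspace (subtopology (prod_topology euclideanreal (vtopo E)) {(t, w). vadd E x (vscale E t w) \<in> U})
      \<rightarrow> {(t, w). vadd F (\<pi> x) (vscale F t w) \<in> V}"
    using E im U x by (auto simp: continuous_lines_def simp flip: linear_between_line[OF lin E subsetD[OF U x]])
qed

context shift_operators
begin

text \<open>Applying the compatibility condition to the remainders \<open>R j t\<close> and \<open>R i t\<close> cancels the difference
  quotients, which are compatible, and leaves a defect independent of \<open>t\<close> that is bounded by the
  norms of the remainders.\<close>

lemma compatible_derivatives:
  fixes E :: "'p tspace" and En :: "nat \<Rightarrow> 'q tspace"
  assumes E: "continuous_lines E" and U: "openin (vtopo E) U" and x: "x \<in> U" and v: "v \<in> vcarrier E"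
    and lin: "\<And>n. n \<ge> s \<Longrightarrow> linear_between E (En n) (\<pi> n)"
    and \<pi>_im: "\<And>n. n \<ge> s \<Longrightarrow> \<pi> n ` U \<subseteq> V n"
    and D: "\<And>n. n \<ge> s \<Longrightarrow> leslie_deriv (En n) (tspace_of (ops n)) (V n) (f n) (\<pi> n x) (D n)"
    and f: "\<And>y. y \<in> U \<Longrightarrow> (\<lambda>n\<in>{s..}. f n (\<pi> n y)) \<in> compat {s..}"
  shows "(\<lambda>n\<in>{s..}. D n (\<pi> n v)) \<in> compat {s..}"
proof (rule compatI)
  have xE: "x \<in> vcarrier E" using openin_subset[OF U] x E by (auto simp: continuous_lines_def)
  note \<pi>_line = linear_between_line[OF lin E xE v]
  note \<pi> = linear_betweenD(1)[OF lin v]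
  have D_closed: "D n w \<in> vcarrier (ops n)" if "n \<ge> s" "w \<in> vcarrier (En n)" for n w
    using D[OF that(1)] that(2) linear_betweenD(1)[of "En n" "tspace_of (ops n)"]
    by (auto simp: leslie_deriv_def)
  have D_scale: "D n (vscale (En n) t w) = vscale (ops n) t (D n w)"
    if "n \<ge> s" "w \<in> vcarrier (En n)" for n t w
    using D[OF that(1)] that(2) linear_betweenD(3)[of "En n" "tspace_of (ops n)"]
    by (auto simp: leslie_deriv_def)
  show "(\<lambda>n\<in>{s..}. D n (\<pi> n v)) i \<in> vcarrier (ops i)" if "i \<in> {s..}" for i
    using that by (simp add: D_closed \<pi>)
  \<comment> \<open>The direction is frozen at \<open>v\<close>: from here on the remainder on level
    \<open>n\<close> is a function of \<open>t\<close> alone.\<close>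
  define R where "R n = (\<lambda>t. leslie_remainder (En n) (tspace_of (ops n)) (f n) (\<pi> n x) (D n) (t, \<pi> n v))"
    for n
  let ?T = "{t. vadd E x (vscale E t v) \<in> U}"
  have T: "open ?T" using open_line_parameters[OF E U xE v] .
  have T0: "0 \<in> ?T" using E xE v x by (simp add: continuous_lines_def)
  \<comment> \<open>The remainder vanishes and is continuous at \<open>(0, \<pi> n v)\<close>; it is
    pulled back along \<open>t \<mapsto> (t, \<pi> n v)\<close>. For \<open>t\<close> in
    \<open>?T\<close> this pair lies in its domain, since \<open>\<pi> n\<close> maps
    \<open>U\<close> into \<open>V n\<close>, and the displaced point stays in \<open>U\<close>,
    where compatibility is known.\<close>
  have small: "\<exists>d>0. \<forall>t. \<bar>t\<bar> < d \<longrightarrow> vadd E x (vscale E t v) \<in> U \<and>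
      R n t \<in> vcarrier (ops n) \<and> vnorm (ops n) (R n t) < e" if n: "n \<ge> s" and e: "e > 0" for n e
  proof -
    let ?X = "subtopology (prod_topology euclideanreal (vtopo (En n)))
      {(t, w). vadd (En n) (\<pi> n x) (vscale (En n) t w) \<in> V n}"
    have at: "topcontinuous_at ?X (ntopo (ops n))
        (leslie_remainder (En n) (tspace_of (ops n)) (f n) (\<pi> n x) (D n)) (0, \<pi> n v)"
      using D[OF n] \<pi>[OF n] by (simp add: leslie_deriv_def)
    then have "\<pi> n v \<in> topspace (vtopo (En n))" by (simp add: topcontinuous_at_def)
    then have line: "continuous_map (subtopology euclideanreal ?T) ?X (\<lambda>t. (t, \<pi> n v))"
      using \<pi>_im[OF n] by (auto simp: continuous_map_in_subtopology continuous_map_pairwise o_def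
          continuous_map_from_subtopology simp flip: \<pi>_line[OF n])
    have "topcontinuous_at (subtopology euclideanreal ?T) (ntopo (ops n)) (R n) 0"
      unfolding R_def
      by (rule topcontinuous_at_compose_continuous_map[OF line at]) (use T0 in simp)
    moreover have "R n 0 = vzero (ops n)" by (simp add: R_def leslie_remainder_def)
    ultimately obtain W where W: "openin (subtopology euclideanreal ?T) W" "0 \<in> W"
      "\<And>t. t \<in> W \<Longrightarrow> ndist (ops n) (vzero (ops n)) (R n t) < e"
      and R: "\<And>t. t \<in> ?T \<Longrightarrow> R n t \<in> vcarrier (ops n)"
      unfolding O.topcontinuous_at_ntopo_iff using e by (auto simp: Pi_iff)
    have "open W" and "W \<subseteq> ?T" using W(1) T openin_open_eq by blast+
    then obtain d where "d > 0" "ball 0 d \<subseteq> W" using W(2) open_contains_ball by blast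
    then have "vadd E x (vscale E t v) \<in> U \<and> R n t \<in> vcarrier (ops n) \<and> vnorm (ops n) (R n t) < e"
      if "\<bar>t\<bar> < d" for t
    proof -
      have t: "t \<in> W" using that \<open>ball 0 d \<subseteq> W\<close> by auto
      then have "t \<in> ?T" using \<open>W \<subseteq> ?T\<close> by blast
      then show ?thesis
        using W(3)[OF t] R[of t]
        by (simp add: O.norm_eq_ndist Metric_space.commute[OF O.Metric_space])
    qed
    then show ?thesis using \<open>d > 0\<close> by blast
  qed
  fix i j y assume "i \<in> {s..}" "j \<in> {s..}" and ij: "i \<le> j"
    and y: "y \<in> vcarrier (local_banach \<nu>2 (j + r))"
  then have i: "i \<ge> s" and j: "j \<ge> s" by auto
  let ?G = "local_banach \<nu>3 (i - s)"
  interpret B: bounded_linear_map "local_banach \<nu>3 (j - s)" ?G "bond \<nu>3 (i - s) (j - s)" 1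
    by (rule bond_target_linear[OF ij])
  define z where "z = bond \<nu>2 (i + r) (j + r) y"
  have z: "z \<in> vcarrier (local_banach \<nu>2 (i + r))"
    unfolding z_def by (rule bond_source_closed[OF ij y])
  define p where "p = bond \<nu>3 (i - s) (j - s) (D j (\<pi> j v) y)"
  define q where "q = D i (\<pi> i v) z"
  have p: "p \<in> vcarrier ?G" unfolding p_def
    by (intro B.closed apply_closed[OF D_closed] j \<pi> y)
  have q: "q \<in> vcarrier ?G" unfolding q_def
    by (intro apply_closed[OF D_closed] i \<pi> z)
  define K where "K = vnorm (local_banach \<nu>2 (j + r)) y + vnorm (local_banach \<nu>2 (i + r)) z"
  have K: "K \<ge> 0" unfolding K_def
    using P.E.norm_nonneg[OF y] P.E.norm_nonneg[OF z] by simp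
  have "ndist ?G p q \<le> e" if "e > 0" for e
  proof -
    define e' where "e' = e / (K + 1)"
    have e': "e' > 0" using that K by (simp add: e'_def)
    obtain di where "di > 0" and di: "\<And>t. \<bar>t\<bar> < di \<Longrightarrow> vadd E x (vscale E t v) \<in> U \<and>
        R i t \<in> vcarrier (ops i) \<and> vnorm (ops i) (R i t) < e'" using small[OF i e'] by blast
    obtain dj where "dj > 0" and dj: "\<And>t. \<bar>t\<bar> < dj \<Longrightarrow>
        R j t \<in> vcarrier (ops j) \<and> vnorm (ops j) (R j t) < e'" using small[OF j e'] by blast
    \<comment> \<open>A single nonzero parameter that serves both levels. No limit in
      \<open>t\<close> is taken: one such \<open>t\<close> for each \<open>e\<close> is enough, as
      the defect does not depend on \<open>t\<close>.\<close>
    define t where "t = min di dj / 2"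
    have t: "t \<noteq> 0" "\<bar>t\<bar> < di" "\<bar>t\<bar> < dj"
      using \<open>di > 0\<close> \<open>dj > 0\<close> by (auto simp: t_def)
    define x' where "x' = vadd E x (vscale E t v)"
    have x': "x' \<in> U" using di[OF t(2)] by (simp add: x'_def)
    have fc: "f n (\<pi> n u) \<in> vcarrier (ops n)" if "u \<in> U" "n \<ge> s" for u n
      using compatD(1)[OF f[OF that(1)], of n] that(2) by simp
    have fb: "bond \<nu>3 (i - s) (j - s) (f j (\<pi> j u) y) = f i (\<pi> i u) z" if "u \<in> U" for u
      using compatD(2)[OF f[OF that], of i j y] i j ij y by (simp add: z_def)
    have R_apply: "R n t w = vscale (local_banach \<nu>3 (n - s)) (1 / t)
        (vminus (local_banach \<nu>3 (n - s))
          (vminus (local_banach \<nu>3 (n - s)) (f n (\<pi> n x') w) (f n (\<pi> n x) w))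
          (vscale (local_banach \<nu>3 (n - s)) t (D n (\<pi> n v) w)))"
      if "n \<ge> s" "w \<in> vcarrier (local_banach \<nu>2 (n + r))" for n w
      using that t(1) by (simp add: R_def leslie_remainder_def ops_apply D_scale \<pi> x'_def \<pi>_line)
    \<comment> \<open>By \<open>fb\<close> at \<open>x'\<close> and at \<open>x\<close>, the
      increment on level \<open>j\<close> evaluated at \<open>y\<close> and pushed down by the
      bonding map is this same vector, so the two remainders share it.\<close>
    define a where "a = vminus ?G (f i (\<pi> i x') z) (f i (\<pi> i x) z)"
    have a: "a \<in> vcarrier ?G"
      unfolding a_def by (intro P.F.minus_closed apply_closed[OF fc] i x' x z)
    have Rj: "bond \<nu>3 (i - s) (j - s) (R j t y) = vscale ?G (1 / t) (vminus ?G a (vscale ?G t p))"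
      using apply_closed[OF fc[OF x' j] y] apply_closed[OF fc[OF x j] y]
        apply_closed[OF D_closed[OF j \<pi>[OF j]] y]
      by (simp add: R_apply j y B.scale B.minus fb x x' a_def p_def)
    have Ri: "R i t z = vscale ?G (1 / t) (vminus ?G a (vscale ?G t q))"
      by (simp add: R_apply i z a_def q_def)
    have "ndist ?G p q = ndist ?G (bond \<nu>3 (i - s) (j - s) (R j t y)) (R i t z)"
      unfolding Rj Ri by (rule P.F.ndist_difference_quotients[OF a p q t(1), symmetric])
    also have "\<dots> \<le> vnorm ?G (bond \<nu>3 (i - s) (j - s) (R j t y)) + vnorm ?G (R i t z)"
    proof -
      have c: "bond \<nu>3 (i - s) (j - s) (R j t y) \<in> vcarrier ?G" "R i t z \<in> vcarrier ?G"
        unfolding Rj Ri using a p q by simp_all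
      show ?thesis
        using Metric_space.triangle[OF P.F.Metric_space c(1) P.F.zero_closed c(2)]
        by (simp add: P.F.norm_eq_ndist c Metric_space.commute[OF P.F.Metric_space, of _ "vzero ?G"])
    qed
    also have "vnorm ?G (bond \<nu>3 (i - s) (j - s) (R j t y))
        \<le> vnorm (ops j) (R j t) * vnorm (local_banach \<nu>2 (j + r)) y"
      using B.bound[of "R j t y"] apply_closed[of "R j t" j y] dj[OF t(3)] y
        P.norm_apply_le[of "R j t" j y] by (simp add: shift_ops_def)
    also have "vnorm ?G (R i t z) \<le> vnorm (ops i) (R i t) * vnorm (local_banach \<nu>2 (i + r)) z"
      using di[OF t(2)] z P.norm_apply_le[of "R i t" i z] by (simp add: shift_ops_def)
    also have "vnorm (ops j) (R j t) * vnorm (local_banach \<nu>2 (j + r)) y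
        + vnorm (ops i) (R i t) * vnorm (local_banach \<nu>2 (i + r)) z \<le> e' * K"
      unfolding K_def distrib_left
      using dj[OF t(3)] di[OF t(2)] P.E.norm_nonneg[OF y] P.E.norm_nonneg[OF z]
      by (intro add_mono mult_right_mono) auto
    also have "\<dots> \<le> e" using K that by (simp add: e'_def field_simps)
    finally show ?thesis by simp
  qed
  then have "ndist ?G p q \<le> 0" by (rule field_le_epsilon[of _ 0, simplified])
  then have "p = q"
    using Metric_space.nonneg[OF P.F.Metric_space, of i p q] Metric_space.zero[OF P.F.Metric_space p q]
    by simp
  then show "bond \<nu>3 (i - s) (j - s) ((\<lambda>n\<in>{s..}. D n (\<pi> n v)) j y)
      = (\<lambda>n\<in>{s..}. D n (\<pi> n v)) i (bond \<nu>2 (i + r) (j + r) y)"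
    using i j by (simp add: p_def q_def z_def)
qed auto

text \<open>The componentwise criterion presupposes a map into the limit space. Compatibility of the
  derivatives is what provides this, first for the candidate derivative and then for the remainder,
  which is a linear combination of compatible families.\<close>

lemma leslie_deriv_projective_limit:
  fixes E :: "'p tspace" and En :: "nat \<Rightarrow> 'q tspace"
  assumes E: "continuous_lines E" and U: "openin (vtopo E) U" and x: "x \<in> U"
    and lin: "\<And>n. n \<ge> s \<Longrightarrow> linear_between E (En n) (\<pi> n)"
    and cont: "\<And>n. n \<ge> s \<Longrightarrow> continuous_map (vtopo E) (vtopo (En n)) (\<pi> n)"
    and \<pi>_im: "\<And>n. n \<ge> s \<Longrightarrow> \<pi> n ` U \<subseteq> V n"
    and D: "\<And>n. n \<ge> s \<Longrightarrow> leslie_deriv (En n) (tspace_of (ops n)) (V n) (f n) (\<pi> n x) (D n)"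
    and f: "\<And>y. y \<in> U \<Longrightarrow> (\<lambda>n\<in>{s..}. f n (\<pi> n y)) \<in> compat {s..}"
  shows "leslie_deriv E (shift_space \<nu>2 \<nu>3 r s) U (\<lambda>y. \<lambda>n\<in>{s..}. f n (\<pi> n y)) x
    (\<lambda>v. \<lambda>n\<in>{s..}. D n (\<pi> n v))"
proof -
  let ?F = "shift_space \<nu>2 \<nu>3 r s"
  let ?f = "\<lambda>y. \<lambda>n\<in>{s..}. f n (\<pi> n y)" and ?D = "\<lambda>v. \<lambda>n\<in>{s..}. D n (\<pi> n v)"
  let ?X = "subtopology (prod_topology euclideanreal (vtopo E)) {(t, w). vadd E x (vscale E t w) \<in> U}"
  have top: "topspace (vtopo E) = vcarrier E" using E by (simp add: continuous_lines_def)
  have UE: "U \<subseteq> vcarrier E" using openin_subset[OF U] top by simp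
  then have xE: "x \<in> vcarrier E" using x by blast
  have \<pi>_closed: "\<pi> n v \<in> vcarrier (En n)" if "n \<ge> s" "v \<in> vcarrier E" for n v
    using linear_betweenD(1)[OF lin] that .
  have D_compat: "?D v \<in> compat {s..}" if "v \<in> vcarrier E" for v
    by (rule compatible_derivatives[OF E U x that, where En = En and V = V and f = f])
      (simp_all add: lin \<pi>_im D f)
  have D_lin: "linear_between (En n) (ops n) (D n)" "continuous_map (vtopo (En n)) (ntopo (ops n)) (D n)"
    "\<And>v. v \<in> vcarrier (En n) \<Longrightarrow> topcontinuous_at
       (subtopology (prod_topology euclideanreal (vtopo (En n)))
          {(t, w). vadd (En n) (\<pi> n x) (vscale (En n) t w) \<in> V n})
       (ntopo (ops n)) (leslie_remainder (En n) (tspace_of (ops n)) (f n) (\<pi> n x) (D n)) (0, v)"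
    if "n \<ge> s" for n
    using D[OF that] by (simp_all add: leslie_deriv_def linear_between_def)
  have D_comp: "continuous_map (vtopo E) (ntopo (ops n)) (\<lambda>v. D n (\<pi> n v))" if "n \<ge> s" for n
    using continuous_map_compose[OF cont[OF that] D_lin(2)[OF that]] by (simp add: o_def)
  have "linear_between E ?F ?D"
    unfolding linear_between_def
  proof (intro conjI ballI allI)
    show "?D \<in> vcarrier E \<rightarrow> vcarrier ?F" using D_compat by simp
    fix v assume v: "v \<in> vcarrier E"
    show "?D (vadd E v w) = vadd ?F (?D v) (?D w)" if "w \<in> vcarrier E" for w
      using v that by (auto simp: linear_betweenD(2)[OF lin] linear_betweenD(2)[OF D_lin(1)] \<pi>_closed
          intro!: restrict_ext)
    show "?D (vscale E c v) = vscale ?F c (?D v)" for c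
      using v by (auto simp: linear_betweenD(3)[OF lin] linear_betweenD(3)[OF D_lin(1)] \<pi>_closed
          intro!: restrict_ext)
  qed
  moreover have "continuous_map (vtopo E) (vtopo ?F) ?D"
    unfolding continuous_map_eq_topcontinuous_at
    using D_comp D_compat top
    by (intro ballI topcontinuous_at_shift_space) (auto simp: continuous_map_eq_topcontinuous_at)
  moreover have "topcontinuous_at ?X (vtopo ?F) (leslie_remainder E ?F ?f x ?D) (0, v)"
    if v: "v \<in> vcarrier E" for v
  proof (rule topcontinuous_at_shift_space)
    show X0: "(0, v) \<in> topspace ?X"
      using E v x UE top by (auto simp: continuous_lines_def)
    have D_scale: "?D (vscale E t w) = vscale ?F t (?D w)" if "w \<in> vcarrier E" for t w
      using linear_betweenD(3)[OF \<open>linear_between E ?F ?D\<close> that] .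
    have closed: "vadd ?F L M \<in> vcarrier ?F" "vscale ?F c L \<in> vcarrier ?F"
      if "L \<in> vcarrier ?F" "M \<in> vcarrier ?F" for L M c
      using that by (simp_all add: compat_add compat_scale)
    have minus: "vminus ?F L M \<in> vcarrier ?F" if "L \<in> vcarrier ?F" "M \<in> vcarrier ?F" for L M
      unfolding vminus_def using that closed by blast
    show "leslie_remainder E ?F ?f x ?D \<in> topspace ?X \<rightarrow> compat {s..}"
    proof
      fix tw assume "tw \<in> topspace ?X"
      then obtain t w where tw: "tw = (t, w)" "vadd E x (vscale E t w) \<in> U" "w \<in> vcarrier E"
        using top by auto
      have "vscale ?F (1 / t) (vminus ?F (vminus ?F (?f (vadd E x (vscale E t w))) (?f x))
          (?D (vscale E t w))) \<in> vcarrier ?F"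
        unfolding D_scale[OF tw(3)] using f[OF tw(2)] f[OF x] D_compat[OF tw(3)]
        by (intro closed minus) (simp_all only: shift_space_simps)
      moreover have "vzero ?F \<in> vcarrier ?F" using compat_zero by simp
      ultimately show "leslie_remainder E ?F ?f x ?D tw \<in> compat {s..}"
        by (simp only: tw(1) leslie_remainder_def prod.case shift_space_simps(1) split: if_split) blast
    qed
    fix n assume n: "n \<ge> s"
    note dom = continuous_map_remainder_domain[OF E UE x lin[OF n] cont[OF n] \<pi>_im[OF n]]
    have "topcontinuous_at ?X (ntopo (ops n))
        (\<lambda>tw. leslie_remainder (En n) (tspace_of (ops n)) (f n) (\<pi> n x) (D n) ((\<lambda>(t, w). (t, \<pi> n w)) tw))
        (0, v)"
      by (rule topcontinuous_at_compose_continuous_map[OF dom _ X0])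
        (simp add: D_lin(3) n \<pi>_closed v)
    then show "topcontinuous_at ?X (ntopo (ops n)) (\<lambda>tw. leslie_remainder E ?F ?f x ?D tw n) (0, v)"
    proof (rule topcontinuous_at_cong)
      fix tw assume "tw \<in> topspace ?X"
      then obtain t w where tw: "tw = (t, w)" "w \<in> vcarrier E"
        using top by auto
      show "leslie_remainder (En n) (tspace_of (ops n)) (f n) (\<pi> n x) (D n) ((\<lambda>(t, w). (t, \<pi> n w)) tw)
          = leslie_remainder E ?F ?f x ?D tw n"
        using n tw(2) by (simp add: tw(1) leslie_remainder_def vminus_def linear_between_line[OF lin[OF n] E] xE
            linear_betweenD(3)[OF lin[OF n]])
    qed
  qed
  ultimately show ?thesis by (simp add: leslie_deriv_def)
qed

text \<open>The spaces, the maps \<open>\<pi>\<close> and the open sets are all generalised in the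
  induction, because passing to the differential changes every one of them. Only the target space
  stays fixed.\<close>

lemma Ck_on_projective_limit:
  fixes E :: "'p pairing tspace" and En :: "nat \<Rightarrow> 'q pairing tspace"
  assumes "continuous_lines E" and "openin (vtopo E) U"
    and "\<And>n. n \<ge> s \<Longrightarrow> topspace (vtopo (En n)) = vcarrier (En n)"
    and "\<And>n. n \<ge> s \<Longrightarrow> linear_between E (En n) (\<pi> n)"
    and "\<And>n. n \<ge> s \<Longrightarrow> continuous_map (vtopo E) (vtopo (En n)) (\<pi> n)"
    and "\<And>n. n \<ge> s \<Longrightarrow> \<pi> n ` U \<subseteq> V n"
    and "\<And>n. n \<ge> s \<Longrightarrow> Ck_on k (En n) (tspace_of (ops n)) (V n) (f n)"
    and "\<And>y. y \<in> U \<Longrightarrow> (\<lambda>n\<in>{s..}. f n (\<pi> n y)) \<in> compat {s..}"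
  shows "Ck_on k E (shift_space \<nu>2 \<nu>3 r s) U (\<lambda>y. \<lambda>n\<in>{s..}. f n (\<pi> n y))"
  using assms
proof (induction k arbitrary: E En U V \<pi> f)
  \<comment> \<open>Proved ahead of the cases, for any order \<open>k\<close>, because continuity is
    required both at order 0 and as the first half of every later order.\<close>
  have cont: "continuous_map (subtopology (vtopo E) U) (vtopo (shift_space \<nu>2 \<nu>3 r s))
      (\<lambda>y. \<lambda>n\<in>{s..}. f n (\<pi> n y))"
    if U: "openin (vtopo E) U"
      and \<pi>: "\<And>n. n \<ge> s \<Longrightarrow> continuous_map (vtopo E) (vtopo (En n)) (\<pi> n)"
        "\<And>n. n \<ge> s \<Longrightarrow> \<pi> n ` U \<subseteq> V n"
      and f: "\<And>n. n \<ge> s \<Longrightarrow> Ck_on k (En n) (tspace_of (ops n)) (V n) (f n)"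
        "\<And>y. y \<in> U \<Longrightarrow> (\<lambda>n\<in>{s..}. f n (\<pi> n y)) \<in> compat {s..}"
    for k and E :: "'p pairing tspace" and En :: "nat \<Rightarrow> 'q pairing tspace" and U V \<pi> f
    unfolding continuous_map_eq_topcontinuous_at
  proof (intro ballI topcontinuous_at_shift_space)
    fix x assume x: "x \<in> topspace (subtopology (vtopo E) U)"
    show "(\<lambda>y. \<lambda>n\<in>{s..}. f n (\<pi> n y)) \<in> topspace (subtopology (vtopo E) U) \<rightarrow> compat {s..}"
      using f(2) by simp
    fix n assume n: "n \<ge> s"
    have "continuous_map (subtopology (vtopo E) U) (subtopology (vtopo (En n)) (V n)) (\<pi> n)"
      using \<pi>[OF n] by (auto simp: continuous_map_in_subtopology continuous_map_from_subtopology)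
    then have "continuous_map (subtopology (vtopo E) U) (ntopo (ops n)) (\<lambda>y. f n (\<pi> n y))"
      using continuous_map_compose[OF _ Ck_on_imp_continuous_map[OF f(1)[OF n]]] by (simp add: o_def)
    then show "topcontinuous_at (subtopology (vtopo E) U) (ntopo (ops n))
        (\<lambda>y. (\<lambda>n\<in>{s..}. f n (\<pi> n y)) n) x"
      using x n by (simp add: continuous_map_eq_topcontinuous_at)
  qed
  {
    case 0
    show ?case
      unfolding Ck_on.simps
      by (rule cont[OF "0.prems"(2,5,6,7,8)])
  next
    case (Suc k)
    note E = Suc.prems(1) and U = Suc.prems(2) and top = Suc.prems(3) and lin = Suc.prems(4)
      and \<pi>_cont = Suc.prems(5) and \<pi>_im = Suc.prems(6)
      and Ck = Suc.prems(7) and f = Suc.prems(8)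
    have topE: "topspace (vtopo E) = vcarrier E" using E by (simp add: continuous_lines_def)
    have UE: "U \<subseteq> vcarrier E" using openin_subset[OF U] topE by simp
    have "\<forall>n\<in>{s..}. \<exists>D. (\<forall>x\<in>V n. leslie_deriv (En n) (tspace_of (ops n)) (V n) (f n) x (D x)) \<and>
        Ck_on k (square_space (En n)) (tspace_of (ops n)) (pairing_set (V n) (vcarrier (En n)))
          (\<lambda>p. D (pfst p) (psnd p))"
      using Ck by simp
    \<comment> \<open>\<open>Ck_on\<close> only asserts that a differential exists on each level;
      one is chosen for every \<open>n\<close>.\<close>
    then obtain D where
      D: "\<And>n x. \<lbrakk>n \<ge> s; x \<in> V n\<rbrakk> \<Longrightarrow> leslie_deriv (En n) (tspace_of (ops n)) (V n) (f n) x (D n x)"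
      and D_Ck: "\<And>n. n \<ge> s \<Longrightarrow> Ck_on k (square_space (En n)) (tspace_of (ops n))
        (pairing_set (V n) (vcarrier (En n))) (\<lambda>p. D n (pfst p) (psnd p))"
      unfolding bchoice_iff by auto
    define Df where "Df x v = (\<lambda>n\<in>{s..}. D n (\<pi> n x) (\<pi> n v))" for x v
    have deriv: "leslie_deriv E (shift_space \<nu>2 \<nu>3 r s) U (\<lambda>y. \<lambda>n\<in>{s..}. f n (\<pi> n y)) x (Df x)"
      if x: "x \<in> U" for x
      unfolding Df_def
      by (rule leslie_deriv_projective_limit[OF E U x lin \<pi>_cont \<pi>_im D f])
        (use x UE \<pi>_im in auto)
    \<comment> \<open>The uncurried differential is written in the shape
      \<open>f n (\<pi> n y)\<close> of the induction hypothesis, with the pair of projections in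
      the role of \<open>\<pi> n\<close>.\<close>
    have "Ck_on k (square_space E) (shift_space \<nu>2 \<nu>3 r s) (pairing_set U (vcarrier E))
        (\<lambda>y. \<lambda>n\<in>{s..}. (\<lambda>p. D n (pfst p) (psnd p)) (Pairing (\<pi> n (pfst y)) (\<pi> n (psnd y))))"
    proof (rule Suc.IH[where En = "\<lambda>n. square_space (En n)"])
      show "continuous_lines (square_space E)" by (rule continuous_lines_square_space[OF E])
      show "openin (vtopo (square_space E)) (pairing_set U (vcarrier E))"
        by (rule openin_square_space[OF U topE])
      fix n assume n: "n \<ge> s"
      show "topspace (vtopo (square_space (En n))) = vcarrier (square_space (En n))"
        using topspace_square_space[OF top[OF n]] by simp
      show "linear_between (square_space E) (square_space (En n))
          (\<lambda>y. Pairing (\<pi> n (pfst y)) (\<pi> n (psnd y)))"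
        by (rule linear_between_square_space[OF lin[OF n]])
      show "continuous_map (vtopo (square_space E)) (vtopo (square_space (En n)))
          (\<lambda>y. Pairing (\<pi> n (pfst y)) (\<pi> n (psnd y)))"
        using continuous_map_compose[OF continuous_map_square_space_proj(1) \<pi>_cont[OF n]]
          continuous_map_compose[OF continuous_map_square_space_proj(2) \<pi>_cont[OF n]] top[OF n]
        by (intro continuous_map_square_space) (simp_all add: o_def)
      show "Ck_on k (square_space (En n)) (tspace_of (ops n)) (pairing_set (V n) (vcarrier (En n)))
          (\<lambda>p. D n (pfst p) (psnd p))"
        by (rule D_Ck[OF n])
      show "(\<lambda>y. Pairing (\<pi> n (pfst y)) (\<pi> n (psnd y))) ` pairing_set U (vcarrier E)
          \<subseteq> pairing_set (V n) (vcarrier (En n))"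
        using \<pi>_im[OF n] linear_betweenD(1)[OF lin[OF n]] by (auto simp: pairing_set_def)
    next
      fix y assume "y \<in> pairing_set U (vcarrier E)"
      then obtain x v where y: "y = Pairing x v" "x \<in> U" "v \<in> vcarrier E"
        by (auto simp: pairing_set_def)
      \<comment> \<open>The compatibility that the induction hypothesis demands on
        \<open>U \<times> E\<close> is contained in \<open>deriv\<close>: the derivative at
        \<open>x\<close> is a linear map into the limit space.\<close>
      have "Df x v \<in> compat {s..}"
        using deriv[OF y(2)] y(3) linear_betweenD(1)[of E "shift_space \<nu>2 \<nu>3 r s"]
        by (auto simp: leslie_deriv_def)
      then show "(\<lambda>n\<in>{s..}. D n (pfst (Pairing (\<pi> n (pfst y)) (\<pi> n (psnd y))))
          (psnd (Pairing (\<pi> n (pfst y)) (\<pi> n (psnd y))))) \<in> compat {s..}"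
        by (simp add: Df_def y(1))
    qed
    then have "Ck_on k (square_space E) (shift_space \<nu>2 \<nu>3 r s) (pairing_set U (vcarrier E))
        (\<lambda>p. Df (pfst p) (psnd p))"
      by (simp add: Df_def)
    then show ?case
      unfolding Ck_on.simps using deriv cont[OF Suc.prems(2,5,6,7,8)] by blast
  }
qed

end

text \<open>Condition (iii) relates consecutive levels only. Functoriality of the bonding maps
  composes these relations into one for all \<open>i \<le> j\<close>; the diagonal case is where
  \<open>bond_self\<close> is needed, because \<open>bond\<close> from a level to itself is the
  identity only on the carrier.\<close>

lemma (in shift_operators) compatI_Suc:
  assumes L: "\<And>i. i \<ge> s \<Longrightarrow> L i \<in> vcarrier (ops i)" and ext: "L \<in> extensional {s..}"
    and Suc: "\<And>n x. \<lbrakk>n \<ge> s; x \<in> vcarrier (local_banach \<nu>2 (Suc n + r))\<rbrakk>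
      \<Longrightarrow> bond \<nu>3 (n - s) (Suc n - s) (L (Suc n) x) = L n (bond \<nu>2 (n + r) (Suc n + r) x)"
  shows "L \<in> compat {s..}"
proof (rule compatI)
  fix i j x assume "i \<in> {s..}" "j \<in> {s..}" "i \<le> j" and x: "x \<in> vcarrier (local_banach \<nu>2 (j + r))"
  then have i: "i \<ge> s" by simp
  show "bond \<nu>3 (i - s) (j - s) (L j x) = L i (bond \<nu>2 (i + r) (j + r) x)"
    using \<open>i \<le> j\<close> x
  proof (induction j arbitrary: x rule: dec_induct)
    case base
    then show ?case using i apply_closed[OF L] by (simp add: bond_self \<nu>2 \<nu>3)
  next
    case (step j)
    have j: "j \<ge> s" using i step.hyps by simp
    have "bond \<nu>3 (i - s) (Suc j - s) (L (Suc j) x)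
        = bond \<nu>3 (i - s) (j - s) (bond \<nu>3 (j - s) (Suc j - s) (L (Suc j) x))"
      using step.hyps step.prems j by (intro bond_bond[OF \<nu>3, symmetric] apply_closed[OF L]) auto
    also have "\<dots> = L i (bond \<nu>2 (i + r) (j + r) (bond \<nu>2 (j + r) (Suc j + r) x))"
      unfolding Suc[OF j step.prems] using step.prems by (intro step.IH bond_source_closed) auto
    also have "bond \<nu>2 (i + r) (j + r) (bond \<nu>2 (j + r) (Suc j + r) x) = bond \<nu>2 (i + r) (Suc j + r) x"
      using step.hyps step.prems by (intro bond_bond[OF \<nu>2]) auto
    finally show ?case .
  qed
qed (use L ext in auto)

theorem theorem4p2p2:
  fixes \<nu>1 :: "nat \<Rightarrow> 'a::real_vector \<Rightarrow> real"
    and \<nu>2 :: "nat \<Rightarrow> 'b::real_vector \<Rightarrow> real"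
    and \<nu>3 :: "nat \<Rightarrow> 'c::real_vector \<Rightarrow> real"
    and r s :: nat
    and U :: "nat \<Rightarrow> (nat \<Rightarrow> 'a set) set set"
    and \<phi> :: "nat \<Rightarrow> (nat \<Rightarrow> 'a set) set \<Rightarrow> (nat \<Rightarrow> 'b set) set \<Rightarrow> (nat \<Rightarrow> 'c set) set"
    and Ulim :: "(nat \<Rightarrow> (nat \<Rightarrow> 'a set) set) set"
  assumes "graded_frechet \<nu>1" and "graded_frechet \<nu>2" and "graded_frechet \<nu>3"
    and "\<And>n. n \<ge> s \<Longrightarrow> openin (ntopo (local_banach \<nu>1 n)) (U n)"
    and "\<And>n. n \<ge> s \<Longrightarrow>
           leslie_smooth (tspace_of (local_banach \<nu>1 n))
             (tspace_of (operator_space (local_banach \<nu>2 (n + r)) (local_banach \<nu>3 (n - s))))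
             (U n) (\<phi> n)"
    and "\<And>n. n \<ge> s \<Longrightarrow> bond \<nu>1 n (n + 1) ` U (n + 1) \<subseteq> U n"
    and "Ulim = {q \<in> vcarrier (frechet_limit \<nu>1). \<forall>n\<ge>s. q n \<in> U n}"
    and "Ulim \<noteq> {}" and "openin (vtopo (frechet_limit \<nu>1)) Ulim"
    and "\<And>q n x. q \<in> Ulim \<Longrightarrow> n \<ge> s \<Longrightarrow> x \<in> vcarrier (local_banach \<nu>2 (n + r + 1)) \<Longrightarrow>
           bond \<nu>3 (n - s) (n - s + 1) (\<phi> (n + 1) (q (n + 1)) x) =
           \<phi> n (q n) (bond \<nu>2 (n + r) (n + r + 1) x)"
  shows "leslie_smooth (frechet_limit \<nu>1) (shift_space \<nu>2 \<nu>3 r s) Ulim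
           (\<lambda>q. \<lambda>n\<in>{s..}. \<phi> n (q n))"
proof -
  note \<nu>1 = assms(1) and U_open = assms(4) and smooth = assms(5) and Ulim = assms(7)
    and Ulim_open = assms(9) and comm = assms(10)
  interpret shift_operators \<nu>2 \<nu>3 r s by unfold_locales (fact assms)+
  interpret L: normed_carrier "local_banach \<nu>1 n" for n
    by (intro normed_carrier_local_banach graded_frechet_seminorm \<nu>1)
  let ?E = "point_space (frechet_limit \<nu>1)"
  let ?En = "\<lambda>n. point_space (tspace_of (local_banach \<nu>1 n))"
  let ?\<pi> = "\<lambda>n p. Point (the_point p n)"
  have Ck: "Ck_on k (?En n) (tspace_of (ops n)) (Point ` U n) (\<lambda>p. \<phi> n (the_point p))"
    if "n \<ge> s" for k n
    using smooth[OF that] by (simp add: leslie_smooth_def shift_ops_def)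
  \<comment> \<open>That \<open>\<phi> n\<close> has operators as values is extracted from
    smoothness: already at order 0 it includes \<open>continuous_map\<close>, hence a map into the
    carrier of the operator space.\<close>
  have \<phi>_closed: "\<phi> n u \<in> vcarrier (ops n)" if n: "n \<ge> s" and u: "u \<in> U n" for n u
  proof -
    have "u \<in> vcarrier (local_banach \<nu>1 n)" using openin_subset[OF U_open[OF n]] u by auto
    then have "Point u \<in> topspace (subtopology (vtopo (?En n)) (Point ` U n))"
      using u by (simp add: topspace_point_space)
    from funcset_mem[OF continuous_map_funspace[OF Ck_on_imp_continuous_map[OF Ck[OF n]]] this]
    show ?thesis by simp
  qed
  have compat: "(\<lambda>n\<in>{s..}. \<phi> n (q n)) \<in> compat {s..}" if q: "q \<in> Ulim" for q
  proof (rule compatI_Suc)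
    show "(\<lambda>n\<in>{s..}. \<phi> n (q n)) i \<in> vcarrier (ops i)" if "i \<ge> s" for i
      using that q by (simp add: Ulim \<phi>_closed)
    \<comment> \<open>For \<open>n \<ge> s\<close> the truncated subtraction satisfies
      \<open>Suc n - s = n - s + 1\<close>, which matches the indices of (iii).\<close>
    fix n x assume "n \<ge> s" "x \<in> vcarrier (local_banach \<nu>2 (Suc n + r))"
    then show "bond \<nu>3 (n - s) (Suc n - s) ((\<lambda>n\<in>{s..}. \<phi> n (q n)) (Suc n) x)
        = (\<lambda>n\<in>{s..}. \<phi> n (q n)) n (bond \<nu>2 (n + r) (Suc n + r) x)"
      using comm[OF q, of n x] by (simp add: Suc_diff_le)
  qed simp
  \<comment> \<open>The limit map is displayed as \<open>f n (\<pi> n p)\<close>, with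
    \<open>\<pi> n\<close> the \<open>n\<close>-th coordinate of a thread wrapped in
    \<open>Point\<close>, to fit the general limit lemma.\<close>
  have "Ck_on k ?E (shift_space \<nu>2 \<nu>3 r s) (Point ` Ulim)
      (\<lambda>p. \<lambda>n\<in>{s..}. (\<lambda>p. \<phi> n (the_point p)) (?\<pi> n p))" for k
  proof (rule Ck_on_projective_limit[where En = ?En and V = "\<lambda>n. Point ` U n"])
    show "continuous_lines ?E"
      by (intro continuous_lines_point_space continuous_lines_frechet_limit \<nu>1)
    show "openin (vtopo ?E) (Point ` Ulim)"
      using Ulim_open by (rule openin_point_space) (auto simp: Ulim)
    fix n assume n: "n \<ge> s"
    show "topspace (vtopo (?En n)) = vcarrier (?En n)"
      by (simp add: topspace_point_space) (simp add: point_space_def)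
    have "linear_between (frechet_limit \<nu>1) (tspace_of (local_banach \<nu>1 n)) (\<lambda>q. q n)"
      by (simp add: linear_between_def frechet_threads_closed)
    then show "linear_between ?E (?En n) (?\<pi> n)" by (rule linear_between_point_space)
    show "continuous_map (vtopo ?E) (vtopo (?En n)) (?\<pi> n)"
      using continuous_map_compose[OF continuous_map_the_point continuous_map_frechet_limit_proj[OF \<nu>1]]
      by (intro continuous_map_point_space) (simp_all add: o_def)
    show "?\<pi> n ` Point ` Ulim \<subseteq> Point ` U n" using n by (auto simp: Ulim)
    show "Ck_on k (?En n) (tspace_of (ops n)) (Point ` U n) (\<lambda>p. \<phi> n (the_point p))"
      by (rule Ck[OF n])
  next
    show "(\<lambda>n\<in>{s..}. \<phi> n (the_point (?\<pi> n y))) \<in> compat {s..}" if "y \<in> Point ` Ulim" for y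
      using that compat by auto
  qed
  then show ?thesis by (simp add: leslie_smooth_def)
qed

end
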